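(* Let $\mathcal{M}$ be a Lawrence oriented matroid of rank $r=9$ on $n\ge 12$ elements. Then $$f_{\mathcal{M}}(9,n,3)\le c_9(n,3).$$
   Context: An oriented matroid $\mathcal{M}=(E,\mathcal{C})$ is given by its finite ground set $E$ and its set $\mathcal{C}\subseteq\{+,-,0\}^E$ of signed circuits; for a sign vector $X$, $X^+$ and $X^-$ are the sets of positive and negative elements and $\underline{X}=X^+\cup X^-$ is the support. All oriented matroids are simple (all circuits have size at least $3$). For $R\subseteq E$, the reorientation ${}_{-R}\mathcal{M}$ is obtained from $\mathcal{M}$ by reversing the sign of $X_e$ for every $e\in R$ and every circuit $X$. For an integer $k\ge 0$, $\mathcal{M}$ is $k$-neighborly if $|X^+|>k$ and $|X^-|>k$ for every circuit $X$. For an oriented matroid $\mathcal{M}$ of rank $r$ on $n$ elements, $f_{\mathcal{M}}(r,n,k)$ denotes the number of subsets $R\subseteq E$ such that ${}_{-R}\mathcal{M}$ is $k$-neighborly. The alternating oriented matroid $C_r(n)$ is the uniform oriented matroid of rank $r$ on $[n]=\{1,\dots,n\}$ in which every circuit $X$ with support $i_1<\dots<i_{r+1}$ satisfies $X_{i_j}=-X_{i_{j+1}}$ for $1\le j\le r$. Put $c_r(n,k)=f_{C_r(n)}(r,n,k)$. Lawrence oriented matroid (LOM): for an $r\times n$ matrix $A=(a_{i,j})$ with entries in $\{+1,-1\}$, $r\le n$, $\mathcal{M}_A$ is the uniform oriented matroid of rank $r$ on $[n]$ with chirotope $\chi(j_1,\dots,j_r)=\prod_{i=1}^r a_{i,j_i}$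 for $j_1<\dots<j_r$. Equivalently, its circuits are the sign vectors $X$ with support $j_1<\dots<j_{r+1}$ such that $X_{j_{i+1}}=-X_{j_i}a_{i,j_i}a_{i,j_{i+1}}$ for $1\le i\le r$. A rank $r$ LOM on $n$ elements is an oriented matroid of the form $\mathcal{M}_A$ for such a matrix $A$. *)

theory Defs
  imports Main
begin

section \<open>Oriented matroids given by signed circuits\<close>

text \<open>
  A sign vector on a ground set is an integer-valued function with values in \<open>{-1, 0, 1}\<close>
  that vanishes outside the ground set.
\<close>

record 'a signed_system =
  ground :: "'a set"
  circuits :: "('a \<Rightarrow> int) set"

definition pos_part :: "('a \<Rightarrow> int) \<Rightarrow> 'a set" where
  "pos_part X = {e. X e = 1}"

definition neg_part :: "('a \<Rightarrow> int) \<Rightarrow> 'a set" where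
  "neg_part X = {e. X e = -1}"

definition supp :: "('a \<Rightarrow> int) \<Rightarrow> 'a set" where
  "supp X = pos_part X \<union> neg_part X"

definition sign_vectors :: "'a set \<Rightarrow> ('a \<Rightarrow> int) set" where
  "sign_vectors E = {X. (\<forall>e\<in>E. X e \<in> {-1, 0, 1}) \<and> (\<forall>e. e \<notin> E \<longrightarrow> X e = 0)}"

definition oriented_matroid :: "'a signed_system \<Rightarrow> bool" where
  "oriented_matroid M \<longleftrightarrow>
     finite (ground M) \<and>
     circuits M \<subseteq> sign_vectors (ground M) \<and>
     (\<forall>X\<in>circuits M. supp X \<noteq> {}) \<and>
     (\<forall>X\<in>circuits M. (\<lambda>e. - X e) \<in> circuits M) \<and>
     (\<forall>X\<in>circuits M. \<forall>Y\<in>circuits M. supp X \<subseteq> supp Y \<longrightarrow> X = Y \<or> X = (\<lambda>e. - Y e)) \<and>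
     (\<forall>X\<in>circuits M. \<forall>Y\<in>circuits M. \<forall>e. X \<noteq> (\<lambda>e. - Y e) \<and> e \<in> pos_part X \<inter> neg_part Y \<longrightarrow>
        (\<exists>Z\<in>circuits M. pos_part Z \<subseteq> (pos_part X \<union> pos_part Y) - {e} \<and>
                          neg_part Z \<subseteq> (neg_part X \<union> neg_part Y) - {e}))"

definition simple :: "'a signed_system \<Rightarrow> bool" where
  "simple M \<longleftrightarrow> (\<forall>X\<in>circuits M. 3 \<le> card (supp X))"

definition om_rank :: "'a signed_system \<Rightarrow> nat" where
  "om_rank M = Max {card I | I. I \<subseteq> ground M \<and> (\<forall>X\<in>circuits M. \<not> supp X \<subseteq> I)}"

definition uniform :: "'a signed_system \<Rightarrow> bool" where
  "uniform M \<longleftrightarrow> supp ` circuits M = {S. S \<subseteq> ground M \<and> card S = om_rank M + 1}"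

definition reorient :: "'a set \<Rightarrow> 'a signed_system \<Rightarrow> 'a signed_system" where
  "reorient R M =
     \<lparr>ground = ground M, circuits = (\<lambda>X e. if e \<in> R then - X e else X e) ` circuits M\<rparr>"

definition neighborly :: "nat \<Rightarrow> 'a signed_system \<Rightarrow> bool" where
  "neighborly k M \<longleftrightarrow> (\<forall>X\<in>circuits M. card (pos_part X) > k \<and> card (neg_part X) > k)"

text \<open>
  The number written \<open>f\<^sub>M(r, n, k)\<close> on paper: the rank \<open>r\<close> and the number of elements \<open>n\<close>
  are determined by \<open>M\<close>.
\<close>

definition num_neighborly :: "'a signed_system \<Rightarrow> nat \<Rightarrow> nat" where
  "num_neighborly M k = card {R. R \<subseteq> ground M \<and> neighborly k (reorient R M)}"


section \<open>Alternating and Lawrence oriented matroids\<close>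

definition alternating :: "nat \<Rightarrow> nat \<Rightarrow> nat signed_system" where
  "alternating r n =
     \<lparr>ground = {1..n},
      circuits = {X \<in> sign_vectors {1..n}. \<exists>j. strict_mono_on {1..r+1} j \<and>
        supp X = j ` {1..r+1} \<and> (\<forall>i\<in>{1..r}. X (j i) = - X (j (i+1)))}\<rparr>"

definition num_neighborly_alternating :: "nat \<Rightarrow> nat \<Rightarrow> nat \<Rightarrow> nat" where
  "num_neighborly_alternating r n k = num_neighborly (alternating r n) k"

definition sign_matrix :: "nat \<Rightarrow> nat \<Rightarrow> (nat \<Rightarrow> nat \<Rightarrow> int) \<Rightarrow> bool" where
  "sign_matrix r n A \<longleftrightarrow> (\<forall>i\<in>{1..r}. \<forall>j\<in>{1..n}. A i j \<in> {1, -1})"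

definition lawrence :: "nat \<Rightarrow> nat \<Rightarrow> (nat \<Rightarrow> nat \<Rightarrow> int) \<Rightarrow> nat signed_system" where
  "lawrence r n A =
     \<lparr>ground = {1..n},
      circuits = {X \<in> sign_vectors {1..n}. \<exists>j. strict_mono_on {1..r+1} j \<and>
        supp X = j ` {1..r+1} \<and>
        (\<forall>i\<in>{1..r}. X (j (i+1)) = - X (j i) * A i (j i) * A i (j (i+1)))}\<rparr>"

definition lawrence_oriented_matroid :: "nat \<Rightarrow> nat \<Rightarrow> nat signed_system \<Rightarrow> bool" where
  "lawrence_oriented_matroid r n M \<longleftrightarrow>
     r \<le> n \<and> (\<exists>A. sign_matrix r n A \<and> M = lawrence r n A)"


section \<open>These systems are oriented matroids\<close>

lemma alternating_eq_lawrence: "alternating r n = lawrence r n (\<lambda>_ _. 1)"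
proof -
  have *: "(x = - y) \<longleftrightarrow> (y = - x * 1 * 1)" for x y :: int by auto
  show ?thesis unfolding alternating_def lawrence_def * ..
qed

text \<open>
  With the chirotope \<open>\<chi>(j\<^sub>1, \<dots>, j\<^sub>r) = a\<^bsub>1,j\<^sub>1\<^esub> \<cdots> a\<^bsub>r,j\<^sub>r\<^esub>\<close>, the circuit with
  support \<open>j\<^sub>1 < \<dots> < j\<^bsub>r+1\<^esub>\<close> is determined by the alternation of
  \<open>X (j i) * \<chi> (j without its i-th entry)\<close>; this is the recursion used above.
\<close>

definition chirotope :: "nat \<Rightarrow> (nat \<Rightarrow> nat \<Rightarrow> int) \<Rightarrow> (nat \<Rightarrow> nat) \<Rightarrow> int" where
  "chirotope r A j = (\<Prod>i\<in>{1..r}. A i (j i))"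

definition omit :: "nat \<Rightarrow> (nat \<Rightarrow> nat) \<Rightarrow> nat \<Rightarrow> nat" where
  "omit i j = (\<lambda>k. if k < i then j k else j (k+1))"

lemma circuit_recursion_chirotope:
  assumes A: "sign_matrix r n A" and j: "\<And>k. k \<in> {1..r+1} \<Longrightarrow> j k \<in> {1..n}" and i: "i \<in> {1..r}"
  shows "X (j (i+1)) = - X (j i) * A i (j i) * A i (j (i+1)) \<longleftrightarrow>
         X (j (i+1)) * chirotope r A (omit (i+1) j) = - (X (j i) * chirotope r A (omit i j))"
proof -
  define P where "P = (\<Prod>k\<in>{1..r}-{i}. A k (omit i j k))"
  have "P = (\<Prod>k\<in>{1..r}-{i}. A k (omit (i+1) j k))"
    unfolding P_def by (intro prod.cong) (auto simp: omit_def)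
  then have 1: "chirotope r A (omit (i+1) j) = A i (j i) * P"
    and 2: "chirotope r A (omit i j) = A i (j (i+1)) * P"
    using i unfolding chirotope_def P_def by (simp_all add: prod.remove[of _ i] omit_def)
  have "P \<noteq> 0"
  proof -
    have "A k (omit i j k) \<noteq> 0" if "k \<in> {1..r}" for k
    proof -
      have "omit i j k \<in> {1..n}"
        using that j[of k] j[of "k+1"] by (auto simp: omit_def)
      then have "A k (omit i j k) \<in> {1,-1}"
        using A that unfolding sign_matrix_def by blast
      then show ?thesis by auto
    qed
    then show ?thesis unfolding P_def by simp
  qed
  then have cancel: "P * x = - (P * y) \<longleftrightarrow> x = - y" for x y
    using mult_cancel_left[of P x "- y"] by simp
  have signs: "A i (j i) \<in> {1,-1}" "A i (j (i+1)) \<in> {1,-1}"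
    using A j i unfolding sign_matrix_def by simp_all
  have "X (j (i+1)) * (A i (j i) * P) = - (X (j i) * (A i (j (i+1)) * P)) \<longleftrightarrow>
        X (j (i+1)) * A i (j i) = - (X (j i) * A i (j (i+1)))"
    by (subst cancel[symmetric]) (simp only: mult_ac)
  then show ?thesis unfolding 1 2 using signs by auto
qed

text \<open>
  For the elimination axiom a circuit is written as the list of its signed elements, in
  increasing order; \<open>chain i\<close> is the defining recursion, starting in row \<open>i\<close>.
\<close>

fun chain :: "(nat \<Rightarrow> nat \<Rightarrow> int) \<Rightarrow> nat \<Rightarrow> (nat \<times> int) list \<Rightarrow> bool" where
  "chain A i ((x,u) # (y,v) # L) \<longleftrightarrow>
     x < y \<and> v * A i y = - (u * A i x) \<and> chain A (Suc i) ((y,v) # L)"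
| "chain A i _ = True"

lemma chain_append:
  "chain A i (K @ (x,u) # (y,v) # L) \<longleftrightarrow>
     chain A i (K @ [(x,u)]) \<and> x < y \<and>
     v * A (i + length K) y = - (u * A (i + length K) x) \<and>
     chain A (Suc (i + length K)) ((y,v) # L)"
proof (induction K arbitrary: i)
  case (Cons a K)
  then show ?case by (cases a; cases K) auto
qed auto

lemma chain_split:
  "chain A i (K @ (x,u) # L) \<longleftrightarrow> chain A i (K @ [(x,u)]) \<and> chain A (i + length K) ((x,u) # L)"
proof (cases L)
  case (Cons b L')
  then show ?thesis by (cases b) (auto simp: chain_append)
qed auto

lemma all_nat_Suc_split: "(\<forall>k. P k) \<longleftrightarrow> P 0 \<and> (\<forall>k. P (Suc k))"
proof (intro iffI conjI allI)
  fix k assume "P 0 \<and> (\<forall>k. P (Suc k))"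
  then show "P k" by (cases k) auto
qed auto

lemma chain_nth:
  "chain A i L \<longleftrightarrow> (\<forall>k. Suc k < length L \<longrightarrow> fst (L ! k) < fst (L ! Suc k) \<and>
     snd (L ! Suc k) * A (i + k) (fst (L ! Suc k)) = - (snd (L ! k) * A (i + k) (fst (L ! k))))"
proof (induction A i L rule: chain.induct)
  case (1 A i x u y v L)
  show ?case
    unfolding chain.simps 1 by (subst (2) all_nat_Suc_split) (auto simp: add_ac)
qed auto

lemma chain_sorted: "chain A i L \<Longrightarrow> sorted_wrt (<) (map fst L)"
  by (auto simp: chain_nth sorted_wrt_iff_nth_Suc_transp)

abbreviation opp :: "(nat \<times> int) list \<Rightarrow> (nat \<times> int) list" where
  "opp \<equiv> map (\<lambda>(x, s). (x, - s))"

context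
  fixes A :: "nat \<Rightarrow> nat \<Rightarrow> int" and r n :: nat and S :: "(nat \<times> int) set"
  assumes A: "sign_matrix r n A"
  defines "S \<equiv> {1..n} \<times> {1, -1}"
begin

lemma signs:
  assumes "(x,u) \<in> S" "(y,v) \<in> S" "i \<in> {1..r}"
  shows "v * A i y = - (u * A i x) \<or> v * A i y = u * A i x"
proof -
  have "A i x \<in> {1,-1}" "A i y \<in> {1,-1}" "u \<in> {1,-1}" "v \<in> {1,-1}"
    using assms A by (auto simp: S_def sign_matrix_def)
  then show ?thesis by auto
qed

lemma opp_signs:
  assumes "(x,u) \<in> S" "(x,v) \<in> S" "i \<in> {1..r}" "v * A i x = - (u * A i x)"
  shows "v = - u"
proof -
  have "A i x \<in> {1,-1}"
    using assms A by (auto simp: S_def sign_matrix_def)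
  with assms(4) show ?thesis by auto
qed

text \<open>A prefix that is one element too long for the suffix that follows it yields a circuit.\<close>

lemma long_prefix:
  assumes "chain A 1 (C @ [(x,w)])" "chain A (Suc (length C)) ((y,v) # L)" "x < y"
    and "length C + length L = r" "set (C @ (x,w) # (y,v) # L) \<subseteq> S"
  shows "\<exists>Z. chain A 1 Z \<and> length Z = r + 1 \<and> set Z \<subseteq> set (C @ (x,w) # (y,v) # L)"
  using assms
proof (induction L arbitrary: C x w y v)
  case Nil
  then show ?case by (intro exI[of _ "C @ [(x,w)]"]) auto
next
  case (Cons b L)
  obtain z t where b: "b = (z,t)" by (cases b)
  let ?k = "Suc (length C)"
  have yz: "y < z" "t * A ?k z = - (v * A ?k y)" and L: "chain A (Suc ?k) ((z,t) # L)"
    using Cons.prems(2) by (auto simp: b)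
  consider "v * A ?k y = - (w * A ?k x)" | "v * A ?k y = w * A ?k x"
    using signs[of x w y v ?k] Cons.prems by fastforce
  then show ?case
  proof cases
    case 1
    have "\<exists>Z. chain A 1 Z \<and> length Z = r + 1 \<and>
            set Z \<subseteq> set ((C @ [(x,w)]) @ (y,v) # (z,t) # L)"
      by (rule Cons.IH) (use Cons.prems 1 yz L in \<open>auto simp: chain_append b\<close>)
    then show ?thesis by (auto simp: b)
  next
    case 2
    then show ?thesis
      using Cons.prems yz L
      by (intro exI[of _ "C @ (x,w) # (z,t) # L"]) (auto simp: chain_append b)
  qed
qed

lemma below:
  assumes "chain A 1 (K @ [(x,s)])" "chain A 1 (K' @ [(x,-s)])" "length K' = length K"
    and "length K \<le> r" "set (K @ [(x,s)]) \<subseteq> S" "set K' \<subseteq> S"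
  shows "K' = opp K \<or> (\<exists>C y w. chain A 1 (C @ [(y,w)]) \<and> length C + 1 = length K + 1 \<and> y < x \<and>
           set (C @ [(y,w)]) \<subseteq> set K \<union> set K')"
  using assms
proof (induction K arbitrary: K' x s rule: rev_induct)
  case (snoc a K)
  obtain y u where a: "a = (y,u)" by (cases a)
  obtain K1 z v where K': "K' = K1 @ [(z,v)]"
    using snoc.prems(3) by (cases K' rule: rev_cases) auto
  have len: "length K1 = length K" using snoc.prems by (simp add: K')
  let ?k = "Suc (length K)"
  have k: "?k \<in> {1..r}" using snoc.prems by simp
  have X: "chain A 1 (K @ [(y,u)])" "y < x" "s * A ?k x = - (u * A ?k y)"
    and Y: "chain A 1 (K1 @ [(z,v)])" "z < x" "- s * A ?k x = - (v * A ?k z)"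
    using snoc.prems(1,2) len by (auto simp: a K' chain_append)
  have in_S: "(y,u) \<in> S" "(z,v) \<in> S" "(x,s) \<in> S" "set K \<subseteq> S" "set K1 \<subseteq> S"
    using snoc.prems by (auto simp: a K')
  have op: "v * A ?k z = - (u * A ?k y)" using X Y by simp
  consider "y < z" | "z < y" | "y = z" by linarith
  then show ?case
  proof cases
    case 1
    then show ?thesis
      using X Y op by (intro disjI2 exI[of _ "K @ [(y,u)]"] exI[of _ z] exI[of _ v])
        (auto simp: chain_append a K')
  next
    case 2
    then show ?thesis
      using X Y op len by (intro disjI2 exI[of _ "K1 @ [(z,v)]"] exI[of _ y] exI[of _ u])
        (auto simp: chain_append a K')
  next
    case 3
    then have v: "v = - u" using opp_signs[of y u v ?k] op in_S k by auto
    have "K1 = opp K \<or> (\<exists>C x' w. chain A 1 (C @ [(x',w)]) \<and> length C + 1 = length K + 1 \<and>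
            x' < y \<and> set (C @ [(x',w)]) \<subseteq> set K \<union> set K1)"
      using snoc.IH[of y u K1] X Y in_S len k 3 v by auto
    then show ?thesis
    proof (elim disjE exE conjE)
      assume "K1 = opp K"
      then show ?thesis by (simp add: a K' 3 v)
    next
      fix C x' w assume C: "chain A 1 (C @ [(x',w)])" "length C + 1 = length K + 1" "x' < y"
        "set (C @ [(x',w)]) \<subseteq> set K \<union> set K1"
      have "(x',w) \<in> S" using C in_S by auto
      then have "\<exists>t\<in>{u,v}. t * A ?k y = - (w * A ?k x')"
        using signs[of x' w y u ?k] in_S k v by auto
      then obtain t where "t \<in> {u,v}" "t * A ?k y = - (w * A ?k x')" by blast
      then show ?thesis
        using C X 3 by (intro disjI2 exI[of _ "C @ [(x',w)]"] exI[of _ y] exI[of _ t])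
          (auto simp: chain_append a K')
    qed
  qed
qed auto

lemma above:
  assumes "chain A i ((x,s) # K)" "chain A i ((x,-s) # K')" "length K' = length K"
    and "1 \<le> i" "i + length K \<le> r + 1" "set ((x,s) # K) \<subseteq> S" "set K' \<subseteq> S"
  shows "K' = opp K \<or> (\<exists>C y w. chain A i ((y,w) # C) \<and> length C = length K \<and> x < y \<and>
           set ((y,w) # C) \<subseteq> set K \<union> set K')"
  using assms
proof (induction K arbitrary: K' x s i)
  case (Cons a K)
  obtain y u where a: "a = (y,u)" by (cases a)
  obtain K1 z v where K': "K' = (z,v) # K1"
    using Cons.prems(3) by (cases K') auto
  have len: "length K1 = length K" using Cons.prems by (simp add: K')
  have k: "i \<in> {1..r}" using Cons.prems by simp
  have X: "chain A (Suc i) ((y,u) # K)" "x < y" "u * A i y = - (s * A i x)"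
    and Y: "chain A (Suc i) ((z,v) # K1)" "x < z" "v * A i z = - (- s * A i x)"
    using Cons.prems(1,2) len by (auto simp: a K')
  have in_S: "(y,u) \<in> S" "(z,v) \<in> S" "(x,s) \<in> S" "set K \<subseteq> S" "set K1 \<subseteq> S"
    using Cons.prems by (auto simp: a K')
  have op: "v * A i z = - (u * A i y)" using X Y by simp
  consider "y < z" | "z < y" | "y = z" by linarith
  then show ?case
  proof cases
    case 1
    then show ?thesis
      using X Y op len by (intro disjI2 exI[of _ "(z,v) # K1"] exI[of _ y] exI[of _ u])
        (auto simp: a K')
  next
    case 2
    then show ?thesis
      using X Y op by (intro disjI2 exI[of _ "(y,u) # K"] exI[of _ z] exI[of _ v])
        (auto simp: a K')
  next
    case 3
    then have v: "v = - u" using opp_signs[of y u v i] op in_S k by auto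
    have "K1 = opp K \<or> (\<exists>C x' w. chain A (Suc i) ((x',w) # C) \<and> length C = length K \<and>
            y < x' \<and> set ((x',w) # C) \<subseteq> set K \<union> set K1)"
      using Cons.IH[of "Suc i" y u K1] X Y in_S len Cons.prems 3 v by auto
    then show ?thesis
    proof (elim disjE exE conjE)
      assume "K1 = opp K"
      then show ?thesis by (simp add: a K' 3 v)
    next
      fix C x' w assume C: "chain A (Suc i) ((x',w) # C)" "length C = length K" "y < x'"
        "set ((x',w) # C) \<subseteq> set K \<union> set K1"
      have "(x',w) \<in> S" using C in_S by auto
      then have "\<exists>t\<in>{u,v}. w * A i x' = - (t * A i y)"
        using signs[of y u x' w i] in_S k v by auto
      then obtain t where "t \<in> {u,v}" "w * A i x' = - (t * A i y)" by blast
      then show ?thesis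
        using C X 3 by (intro disjI2 exI[of _ "(x',w) # C"] exI[of _ y] exI[of _ t])
          (auto simp: a K')
    qed
  qed
qed auto

lemma elim_same_position:
  assumes X: "chain A 1 (K @ (x,s) # L)" and Y: "chain A 1 (K' @ (x,-s) # L')"
    and len: "length K' = length K" "length L' = length L" "length K + length L = r"
    and in_S: "set (K @ (x,s) # L) \<subseteq> S" "set (K' @ L') \<subseteq> S"
    and ne: "K' @ (x,-s) # L' \<noteq> opp (K @ (x,s) # L)"
  shows "\<exists>Z. chain A 1 Z \<and> length Z = r + 1 \<and> set Z \<subseteq> set (K @ L) \<union> set (K' @ L')"
proof -
  let ?k = "Suc (length K)"
  have X1: "chain A 1 (K @ [(x,s)])" "chain A ?k ((x,s) # L)"
    using X unfolding chain_split[of A 1 K x s L] by simp_all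
  have Y1: "chain A 1 (K' @ [(x,-s)])" "chain A ?k ((x,-s) # L')"
    using Y len unfolding chain_split[of A 1 K' x "-s" L'] by simp_all
  consider "K' \<noteq> opp K" | "L' \<noteq> opp L" using ne by auto
  then show ?thesis
  proof cases
    case 1
    then obtain C y w where C: "chain A 1 (C @ [(y,w)])" "length C = length K" "y < x"
        "set (C @ [(y,w)]) \<subseteq> set K \<union> set K'"
      using below[of K x s K'] X1 Y1 len in_S by auto
    show ?thesis
    proof (cases L)
      case Nil
      then show ?thesis using C len by (intro exI[of _ "C @ [(y,w)]"]) auto
    next
      case (Cons b M)
      then obtain z u where L: "L = (z,u) # M" by (cases b) auto
      obtain z' u' M' where L': "L' = (z',u') # M'"
        using len L by (cases L') auto
      have k: "?k \<in> {1..r}" using len L by simp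
      have zu: "x < z" "u * A ?k z = - (s * A ?k x)" "chain A (Suc ?k) ((z,u) # M)"
        using X1 by (auto simp: L)
      have zu': "x < z'" "u' * A ?k z' = s * A ?k x" "chain A (Suc ?k) ((z',u') # M')"
        using Y1 by (auto simp: L')
      have "(y,w) \<in> S" "(x,s) \<in> S" using C in_S by auto
      then consider "s * A ?k x = - (w * A ?k y)" | "s * A ?k x = w * A ?k y"
        using signs[of y w x s ?k] k by auto
      then show ?thesis
      proof cases
        case 1
        then show ?thesis
          using C zu' len by (intro exI[of _ "C @ (y,w) # (z',u') # M'"])
            (auto simp: chain_append L L')
      next
        case 2
        then show ?thesis
          using C zu len by (intro exI[of _ "C @ (y,w) # (z,u) # M"])
            (auto simp: chain_append L L')
      qed
    qed
  next
    case 2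
    then obtain C y w where C: "chain A ?k ((y,w) # C)" "length C = length L" "x < y"
        "set ((y,w) # C) \<subseteq> set L \<union> set L'"
      using above[of ?k x s L L'] X1 Y1 len in_S by auto
    show ?thesis
    proof (cases K rule: rev_cases)
      case Nil
      then show ?thesis using C len by (intro exI[of _ "(y,w) # C"]) auto
    next
      case (snoc M b)
      then obtain z u where K: "K = M @ [(z,u)]" by (cases b) auto
      obtain z' u' M' where K': "K' = M' @ [(z',u')]"
        using len K by (cases K' rule: rev_cases) auto
      let ?m = "length K"
      have k: "?m \<in> {1..r}" using len K by simp
      have zu: "z < x" "s * A ?m x = - (u * A ?m z)" "chain A 1 (M @ [(z,u)])"
        using X1 by (auto simp: K chain_append)
      have zu': "z' < x" "- s * A ?m x = - (u' * A ?m z')" "chain A 1 (M' @ [(z',u')])"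
        using Y1 len by (auto simp: K K' chain_append)
      have "(y,w) \<in> S" "(x,s) \<in> S" using C in_S by auto
      then consider "w * A ?m y = - (s * A ?m x)" | "w * A ?m y = s * A ?m x"
        using signs[of x s y w ?m] k by auto
      then show ?thesis
      proof cases
        case 1
        then show ?thesis
          using C zu' len by (intro exI[of _ "M' @ (z',u') # (y,w) # C"])
            (auto simp: chain_append K K')
      next
        case 2
        then show ?thesis
          using C zu len by (intro exI[of _ "M @ (z,u) # (y,w) # C"])
            (auto simp: chain_append K K')
      qed
    qed
  qed
qed

lemma elim_earlier_position:
  assumes X: "chain A 1 (K @ (x,s) # L)" and Y: "chain A 1 (K' @ (x,-s) # L')"
    and len: "length K < length K'" "length K + length L = r" "length K' + length L' = r"
    and in_S: "set (K @ (x,s) # L) \<subseteq> S" "set (K' @ L') \<subseteq> S"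
  shows "\<exists>Z. chain A 1 Z \<and> length Z = r + 1 \<and> set Z \<subseteq> set (K @ L) \<union> set (K' @ L')"
proof -
  let ?k = "Suc (length K)"
  obtain y u M where L: "L = (y,u) # M" using len by (cases L) auto
  have X1: "x < y" "u * A ?k y = - (s * A ?k x)" "chain A (Suc ?k) ((y,u) # M)"
    using X by (auto simp: L chain_append)
  define B where "B = take (length K) K'"
  obtain z w D where D: "drop (length K) K' = (z,w) # D"
    using len by (cases "drop (length K) K'") auto
  have K': "K' = B @ (z,w) # D" and lB: "length B = length K"
    unfolding B_def D[symmetric] using len by auto
  show ?thesis
  proof (cases D)
    case Nil
    then have "z < x" "- s * A ?k x = - (w * A ?k z)" "chain A 1 (B @ [(z,w)])"
      using Y lB by (auto simp: K' chain_append)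
    then show ?thesis
      using X1 lB len by (intro exI[of _ "B @ (z,w) # (y,u) # M"]) (auto simp: K' L chain_append)
  next
    case (Cons b D')
    then obtain z' w' where D: "D = (z',w') # D'" by (cases b) auto
    have Y': "chain A 1 ((B @ [(z,w),(z',w')]) @ D' @ (x,-s) # L')"
      using Y by (simp add: K' D)
    have "z' < x"
      using chain_sorted[OF Y'] by (auto simp: sorted_wrt_append)
    have "chain A 1 (B @ [(z,w),(z',w')])"
      using Y' by (cases "D' @ (x,-s) # L'") (auto simp: chain_append)
    then have "\<exists>Z. chain A 1 Z \<and> length Z = r + 1 \<and>
        set Z \<subseteq> set ((B @ [(z,w)]) @ (z',w') # (y,u) # M)"
      using X1 \<open>z' < x\<close> len in_S lB
      by (intro long_prefix) (auto simp: K' D L)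
    then show ?thesis by (auto simp: K' D L)
  qed
qed

lemma chain_elim:
  assumes X: "chain A 1 P" "length P = r + 1" "set P \<subseteq> S"
    and Y: "chain A 1 Q" "length Q = r + 1" "set Q \<subseteq> S"
    and e: "(e,s) \<in> set P" "(e,-s) \<in> set Q" and ne: "Q \<noteq> opp P"
  shows "\<exists>Z. chain A 1 Z \<and> length Z = r + 1 \<and> set Z \<subseteq> set P \<union> set Q \<and> e \<notin> fst ` set Z"
proof -
  obtain K L where P: "P = K @ (e,s) # L" using e by (meson split_list)
  obtain K' L' where Q: "Q = K' @ (e,-s) # L'" using e by (meson split_list)
  have dist: "e \<notin> fst ` (set (K @ L) \<union> set (K' @ L'))"
    using chain_sorted[OF X(1)] chain_sorted[OF Y(1)]
    by (fastforce simp: P Q sorted_wrt_append)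
  consider "length K = length K'" | "length K < length K'" | "length K' < length K" by linarith
  then have "\<exists>Z. chain A 1 Z \<and> length Z = r + 1 \<and> set Z \<subseteq> set (K @ L) \<union> set (K' @ L')"
  proof cases
    case 1
    show ?thesis by (rule elim_same_position[of K e s L]) (use X Y ne 1 in \<open>auto simp: P Q\<close>)
  next
    case 2
    show ?thesis by (rule elim_earlier_position[of K e s L]) (use X Y 2 in \<open>auto simp: P Q\<close>)
  next
    case 3
    have "\<exists>Z. chain A 1 Z \<and> length Z = r + 1 \<and> set Z \<subseteq> set (K' @ L') \<union> set (K @ L)"
      by (rule elim_earlier_position[of K' e "-s" L']) (use X Y 3 in \<open>auto simp: P Q\<close>)
    then show ?thesis by (simp add: Un_commute)
  qed
  then obtain Z where "chain A 1 Z" "length Z = r + 1" "set Z \<subseteq> set (K @ L) \<union> set (K' @ L')"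
    by blast
  with dist show ?thesis by (intro exI[of _ Z]) (auto simp: P Q)
qed

lemma chain_unique:
  assumes "chain A i P" "chain A i Q" "map fst P = map fst Q" "set P \<subseteq> S" "set Q \<subseteq> S"
    and "1 \<le> i" "i + length P \<le> r + 2"
  shows "Q = P \<or> Q = opp P"
  using assms
proof (induction P arbitrary: Q i)
  case (Cons a P)
  obtain x u where a: "a = (x,u)" by (cases a)
  obtain v Q' where Q: "Q = (x,v) # Q'" using Cons.prems(3) by (cases Q) (auto simp: a)
  have uv: "u \<in> {1,-1}" "v \<in> {1,-1}" using Cons.prems by (auto simp: a Q S_def)
  show ?case
  proof (cases P)
    case Nil
    then show ?thesis using uv Cons.prems(3) by (auto simp: a Q)
  next
    case (Cons b P')
    obtain y w where b: "b = (y,w)" by (cases b)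
    obtain w' Q1 where Q': "Q' = (y,w') # Q1"
      using Cons.prems(3) by (cases Q') (auto simp: a Q Cons b)
    have i: "i \<in> {1..r}" using Cons.prems by (simp add: Cons)
    have 1: "w * A i y = - (u * A i x)" "chain A (Suc i) P"
      using Cons.prems(1) by (auto simp: a Cons b)
    have 2: "w' * A i y = - (v * A i x)" "chain A (Suc i) Q'"
      using Cons.prems(2) by (auto simp: Q Q')
    have "Q' = P \<or> Q' = opp P"
      by (rule Cons.IH[of "Suc i"]) (use 1 2 Cons.prems in \<open>auto simp: a Q\<close>)
    moreover have "A i x \<in> {1,-1}"
      using A i Cons.prems by (auto simp: a S_def sign_matrix_def)
    ultimately show ?thesis using 1 2 by (auto simp: a Q Q' Cons b)
  qed
qed auto

lemma circuit_iff:
  "X \<in> circuits (lawrence r n A) \<longleftrightarrow>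
     (\<exists>L. chain A 1 L \<and> length L = r + 1 \<and> set L \<subseteq> S \<and>
          (\<forall>e s. (e,s) \<in> set L \<longleftrightarrow> X e = s \<and> s \<noteq> 0))" (is "?L \<longleftrightarrow> ?R")
proof
  assume ?L
  then obtain j where X: "X \<in> sign_vectors {1..n}" and j: "strict_mono_on {1..r+1} j"
    "supp X = j ` {1..r+1}" "\<forall>i\<in>{1..r}. X (j (i+1)) = - X (j i) * A i (j i) * A i (j (i+1))"
    by (auto simp: lawrence_def)
  have supp: "e \<in> supp X \<longleftrightarrow> X e \<noteq> 0" "e \<in> supp X \<Longrightarrow> e \<in> {1..n} \<and> X e \<in> {1,-1}" for e
    using X by (auto simp: sign_vectors_def supp_def pos_part_def neg_part_def)
  define L where "L = map (\<lambda>k. (j k, X (j k))) [1..<r+2]"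
  have set_L: "set L = (\<lambda>e. (e, X e)) ` supp X"
    unfolding L_def j(2) set_map image_image by (rule image_cong) (auto simp del: upt_Suc)
  have "chain A 1 L"
    unfolding chain_nth
  proof (intro allI impI)
    fix k assume "Suc k < length L"
    then have k: "k < r" by (simp add: L_def del: upt_Suc)
    have "j (k+1) < j (k+2)" using j(1) k by (auto simp: strict_mono_on_def)
    moreover have "X (j (k+2)) = - X (j (k+1)) * A (k+1) (j (k+1)) * A (k+1) (j (k+2))"
      using j(3) k by force
    moreover have "j (k+2) \<in> {1..n}" using supp(2)[of "j (k+2)"] j(2) k by auto
    then have "A (k+1) (j (k+2)) \<in> {1,-1}" using A k unfolding sign_matrix_def by auto
    ultimately show "fst (L ! k) < fst (L ! Suc k) \<and>
       snd (L ! Suc k) * A (1 + k) (fst (L ! Suc k)) = - (snd (L ! k) * A (1 + k) (fst (L ! k)))"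
      using k by (auto simp: L_def nth_append simp del: upt_Suc)
  qed
  moreover have "set L \<subseteq> S" using supp(2) by (force simp: set_L S_def)
  moreover have "length L = r + 1" by (simp add: L_def del: upt_Suc)
  moreover have "(e,s) \<in> set L \<longleftrightarrow> X e = s \<and> s \<noteq> 0" for e s
    by (auto simp: set_L supp(1))
  ultimately show ?R by blast
next
  assume ?R
  then obtain L where L: "chain A 1 L" "length L = r + 1" "set L \<subseteq> S"
    and X: "\<And>e s. (e,s) \<in> set L \<longleftrightarrow> X e = s \<and> s \<noteq> 0" by blast
  have XS: "X e \<noteq> 0 \<Longrightarrow> (e, X e) \<in> S" for e using X[of e "X e"] L by auto
  define j where "j k = fst (L ! (k - 1))" for k
  have Xj: "X (j k) = snd (L ! (k - 1))" "j k \<in> {1..n}" if "k \<in> {1..r+1}" for k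
  proof -
    have "L ! (k - 1) \<in> set L" using that L(2) by (intro nth_mem) auto
    then show "X (j k) = snd (L ! (k - 1))" "j k \<in> {1..n}"
      using X[of "fst (L ! (k - 1))" "snd (L ! (k - 1))"] L(3) by (auto simp: j_def S_def)
  qed
  have "sorted_wrt (<) (map fst L)" by (rule chain_sorted[OF L(1)])
  then have "j a < j b" if "a \<in> {1..r+1}" "b \<in> {1..r+1}" "a < b" for a b
    using sorted_wrt_nth_less[of "(<)" "map fst L" "a - 1" "b - 1"] that L(2)
    by (simp add: j_def)
  then have "strict_mono_on {1..r+1} j"
    by (auto simp: strict_mono_on_def)
  moreover have "supp X = j ` {1..r+1}"
  proof -
    have "supp X = fst ` set L"
    proof (intro equalityI subsetI)
      fix e assume "e \<in> supp X"
      then have "(e, X e) \<in> set L" using X by (auto simp: supp_def pos_part_def neg_part_def)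
      then show "e \<in> fst ` set L" by force
    next
      fix e assume "e \<in> fst ` set L"
      then have "X e \<noteq> 0" using X by auto
      then show "e \<in> supp X"
        using XS[of e] by (auto simp: S_def supp_def pos_part_def neg_part_def)
    qed
    also have "\<dots> = (\<lambda>k. fst (L ! k)) ` {..<r+1}"
      using L(2) by (auto simp: set_conv_nth)
    also have "{..<r+1} = (\<lambda>k. k - 1) ` {1..r+1}"
      by (force intro: image_eqI[of _ _ "Suc _"])
    finally show ?thesis by (simp add: image_image j_def)
  qed
  moreover have "X (j (i+1)) = - X (j i) * A i (j i) * A i (j (i+1))" if i: "i \<in> {1..r}" for i
  proof -
    obtain k where k: "i = Suc k" using i by (cases i) auto
    have "X (j (i+1)) * A i (j (i+1)) = - (X (j i) * A i (j i))"
      using L(1)[unfolded chain_nth, rule_format, of k] L(2) i Xj(1)[of i] Xj(1)[of "i+1"]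
      by (simp add: j_def k)
    moreover have "A i (j (i+1)) \<in> {1,-1}"
      using A i Xj(2)[of "i+1"] by (auto simp: sign_matrix_def)
    ultimately show ?thesis by auto
  qed
  moreover have "X \<in> sign_vectors {1..n}"
    unfolding sign_vectors_def using XS by (auto simp: S_def)
  ultimately show ?L by (auto simp: lawrence_def)
qed

lemma circuitE:
  assumes "X \<in> circuits (lawrence r n A)"
  obtains L where "chain A 1 L" "length L = r + 1" "set L \<subseteq> S"
    "\<And>e s. (e,s) \<in> set L \<longleftrightarrow> X e = s \<and> s \<noteq> 0" "supp X = set (map fst L)"
proof -
  obtain L where L: "chain A 1 L" "length L = r + 1" "set L \<subseteq> S"
    "\<And>e s. (e,s) \<in> set L \<longleftrightarrow> X e = s \<and> s \<noteq> 0"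
    using assms unfolding circuit_iff by blast
  have "X e \<in> {1,-1}" if "X e \<noteq> 0" for e
    using L(3) L(4)[of e "X e"] that by (auto simp: S_def)
  then have "e \<in> supp X \<longleftrightarrow> X e \<noteq> 0" for e
    by (auto simp: supp_def pos_part_def neg_part_def)
  then have "supp X = set (map fst L)"
    using L(4) by (auto simp: image_iff Bex_def)
  with L show thesis by (rule that)
qed

lemma circuit_of_chain:
  assumes "chain A 1 L" "length L = r + 1" "set L \<subseteq> S"
  obtains X where "X \<in> circuits (lawrence r n A)"
    "\<And>e s. (e,s) \<in> set L \<longleftrightarrow> X e = s \<and> s \<noteq> 0"
proof -
  have d: "distinct (map fst L)"
    using chain_sorted[OF assms(1)] by (simp add: strict_sorted_iff)
  define X where "X e = (case map_of L e of None \<Rightarrow> 0 | Some s \<Rightarrow> s)" for e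
  have "s \<noteq> 0" if "(e,s) \<in> set L" for e s using that assms(3) by (auto simp: S_def)
  then have "(e,s) \<in> set L \<longleftrightarrow> X e = s \<and> s \<noteq> 0" for e s
    using map_of_eq_Some_iff[OF d, of e s]
    by (auto simp: X_def split: option.splits dest: map_of_SomeD)
  then show thesis using assms by (intro that[of X]) (auto simp: circuit_iff)
qed

lemma chain_opp: "chain A i (opp L) \<longleftrightarrow> chain A i L"
  by (induction A i L rule: chain.induct) (auto simp: neg_eq_iff_add_eq_0)

lemma opp_circuit:
  assumes "X \<in> circuits (lawrence r n A)"
  shows "(\<lambda>e. - X e) \<in> circuits (lawrence r n A)"
proof -
  obtain L where L: "chain A 1 L" "length L = r + 1" "set L \<subseteq> S"
    "\<And>e s. (e,s) \<in> set L \<longleftrightarrow> X e = s \<and> s \<noteq> 0"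
    using assms unfolding circuit_iff by blast
  have "(e,s) \<in> set (opp L) \<longleftrightarrow> (e,-s) \<in> set L" for e s by force
  then have "(e,s) \<in> set (opp L) \<longleftrightarrow> - X e = s \<and> s \<noteq> 0" for e s
    unfolding L(4) by auto
  moreover have "set (opp L) \<subseteq> S" using L(3) by (auto simp: S_def)
  ultimately show ?thesis
    unfolding circuit_iff using L(1,2)
    by (intro exI[of _ "opp L"]) (simp add: chain_opp)
qed

lemma card_supp_circuit: "X \<in> circuits (lawrence r n A) \<Longrightarrow> card (supp X) = r + 1"
  by (erule circuitE) (metis chain_sorted distinct_card length_map strict_sorted_iff)

theorem oriented_matroid_lawrence: "oriented_matroid (lawrence r n A)" (is "oriented_matroid ?M")
  unfolding oriented_matroid_def
proof (intro conjI ballI allI impI)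
  show "finite (ground ?M)" "circuits ?M \<subseteq> sign_vectors (ground ?M)"
    by (auto simp: lawrence_def)
next
  fix X assume X: "X \<in> circuits ?M"
  show "supp X \<noteq> {}" using card_supp_circuit[OF X] by auto
  show "(\<lambda>e. - X e) \<in> circuits ?M" by (rule opp_circuit[OF X])
next
  fix X Y assume X: "X \<in> circuits ?M" and Y: "Y \<in> circuits ?M" and sub: "supp X \<subseteq> supp Y"
  obtain P where P: "chain A 1 P" "length P = r + 1" "set P \<subseteq> S"
    "\<And>e s. (e,s) \<in> set P \<longleftrightarrow> X e = s \<and> s \<noteq> 0" "supp X = set (map fst P)"
    using circuitE[OF X] by blast
  obtain Q where Q: "chain A 1 Q" "length Q = r + 1" "set Q \<subseteq> S"
    "\<And>e s. (e,s) \<in> set Q \<longleftrightarrow> Y e = s \<and> s \<noteq> 0" "supp Y = set (map fst Q)"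
    using circuitE[OF Y] by blast
  have "supp X = supp Y"
    using sub card_supp_circuit[OF X] card_supp_circuit[OF Y]
    by (intro card_subset_eq) (auto simp: Q(5))
  then have "map fst P = map fst Q"
    using chain_sorted[OF P(1)] chain_sorted[OF Q(1)] P(5) Q(5)
    by (intro strict_sorted_equal) auto
  then consider "P = Q" | "P = opp Q"
    using chain_unique[OF Q(1) P(1)] P Q by auto
  then show "X = Y \<or> X = (\<lambda>e. - Y e)"
  proof cases
    case 1
    then have "X e = Y e" for e using P(4)[of e "X e"] Q(4)[of e "X e"] Q(4)[of e "Y e"] P(4)[of e "Y e"] by auto
    then show ?thesis by auto
  next
    case 2
    have "(e,s) \<in> set (opp Q) \<longleftrightarrow> (e,-s) \<in> set Q" for e s by force
    then have *: "X e = s \<and> s \<noteq> 0 \<longleftrightarrow> Y e = - s \<and> s \<noteq> 0" for e s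
      using P(4)[of e s] Q(4)[of e "-s"] 2 by auto
    have "X e = - Y e" for e using *[of e "X e"] *[of e "- Y e"] by auto
    then show ?thesis by auto
  qed
next
  fix X Y e assume X: "X \<in> circuits ?M" and Y: "Y \<in> circuits ?M"
    and ne: "X \<noteq> (\<lambda>e. - Y e) \<and> e \<in> pos_part X \<inter> neg_part Y"
  obtain P where P: "chain A 1 P" "length P = r + 1" "set P \<subseteq> S"
    "\<And>e s. (e,s) \<in> set P \<longleftrightarrow> X e = s \<and> s \<noteq> 0" "supp X = set (map fst P)"
    using circuitE[OF X] by blast
  obtain Q where Q: "chain A 1 Q" "length Q = r + 1" "set Q \<subseteq> S"
    "\<And>e s. (e,s) \<in> set Q \<longleftrightarrow> Y e = s \<and> s \<noteq> 0" "supp Y = set (map fst Q)"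
    using circuitE[OF Y] by blast
  have "Q \<noteq> opp P"
  proof
    assume *: "Q = opp P"
    have "(e,s) \<in> set (opp P) \<longleftrightarrow> (e,-s) \<in> set P" for e s by force
    then have *: "Y e = s \<and> s \<noteq> 0 \<longleftrightarrow> X e = - s \<and> s \<noteq> 0" for e s
      using P(4)[of e "-s"] Q(4)[of e s] * by auto
    have "X e = - Y e" for e using *[of e "Y e"] *[of e "- X e"] by auto
    with ne show False by auto
  qed
  then obtain L where L: "chain A 1 L" "length L = r + 1" "set L \<subseteq> set P \<union> set Q"
    "e \<notin> fst ` set L"
    using chain_elim[OF P(1-3) Q(1-3), of e 1] ne P(4) Q(4)
    by (auto simp: pos_part_def neg_part_def)
  obtain Z where Z: "Z \<in> circuits ?M" "\<And>e s. (e,s) \<in> set L \<longleftrightarrow> Z e = s \<and> s \<noteq> 0"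
    using circuit_of_chain[OF L(1,2)] L(3) P(3) Q(3) by blast
  have Z_val: "(X a = s \<or> Y a = s) \<and> a \<noteq> e" if "Z a = s" "s \<noteq> 0" for a s
    using that Z(2)[of a s] L(3,4) P(4)[of a s] Q(4)[of a s] by force
  then show "\<exists>Z\<in>circuits ?M. pos_part Z \<subseteq> (pos_part X \<union> pos_part Y) - {e} \<and>
      neg_part Z \<subseteq> (neg_part X \<union> neg_part Y) - {e}"
    using Z(1) by (intro bexI[of _ Z]) (fastforce simp: pos_part_def neg_part_def)+
qed

text \<open>Every \<open>(r+1)\<close>-subset supports a circuit, so the rank is \<open>r\<close>.\<close>

lemma chain_exists:
  assumes "sorted_wrt (<) (a # xs)" "set (a # xs) \<subseteq> {1..n}" "1 \<le> i" "i + length xs \<le> r + 1"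
    and "u \<in> {1,-1}"
  shows "\<exists>L. chain A i ((a,u) # L) \<and> map fst L = xs \<and> set L \<subseteq> S"
  using assms
proof (induction xs arbitrary: a u i)
  case (Cons b xs)
  have ab: "A i a \<in> {1,-1}" "A i b \<in> {1,-1}"
    using A Cons.prems by (auto simp: sign_matrix_def)
  define v where "v = - (u * A i a * A i b)"
  have v: "v \<in> {1,-1}" "v * A i b = - (u * A i a)"
    using ab Cons.prems(5) by (auto simp: v_def)
  obtain L where "chain A (Suc i) ((b,v) # L)" "map fst L = xs" "set L \<subseteq> S"
    using Cons.IH[of b "Suc i" v] Cons.prems v by auto
  then show ?case
    using v Cons.prems by (intro exI[of _ "(b,v) # L"]) (auto simp: S_def)
qed auto

lemma supp_circuits:
  "supp ` circuits (lawrence r n A) = {T. T \<subseteq> {1..n} \<and> card T = r + 1}"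
proof (intro equalityI subsetI)
  fix T assume "T \<in> supp ` circuits (lawrence r n A)"
  then obtain X where X: "X \<in> circuits (lawrence r n A)" "T = supp X" by auto
  then have "X \<in> sign_vectors {1..n}" by (simp add: lawrence_def)
  then have "T \<subseteq> {1..n}"
    unfolding X(2) sign_vectors_def supp_def pos_part_def neg_part_def by force
  then show "T \<in> {T. T \<subseteq> {1..n} \<and> card T = r + 1}" using card_supp_circuit X by auto
next
  fix T assume T: "T \<in> {T. T \<subseteq> {1..n} \<and> card T = r + 1}"
  then have fin: "finite T" using finite_subset by auto
  define xs where "xs = sorted_list_of_set T"
  have xs: "sorted_wrt (<) xs" "set xs = T" "length xs = r + 1"
    using T fin by (auto simp: xs_def)
  then obtain a ys where ys: "xs = a # ys" by (cases xs) auto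
  obtain L where L: "chain A 1 ((a,1) # L)" "map fst L = ys" "set L \<subseteq> S"
    using chain_exists[of a ys 1 1] xs T ys by auto
  have len: "length ((a,1) # L) = r + 1"
    using L(2)[symmetric] xs(3) ys by simp
  have "set ((a,1) # L) \<subseteq> S"
    using L(3) xs(2) T ys by (auto simp: S_def)
  then obtain X where X: "X \<in> circuits (lawrence r n A)"
    "\<And>e s. (e,s) \<in> set ((a,1) # L) \<longleftrightarrow> X e = s \<and> s \<noteq> 0"
    using circuit_of_chain[OF L(1) len] \<open>set ((a,1) # L) \<subseteq> S\<close> by blast
  have "T = set (map fst ((a,1::int) # L))"
    unfolding list.map L(2) xs(2)[symmetric] ys by simp
  then have "T = fst ` set ((a,1) # L)" unfolding set_map .
  also have "\<dots> \<subseteq> supp X"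
  proof
    fix e assume "e \<in> fst ` set ((a,1) # L)"
    then obtain s where "(e,s) \<in> set ((a,1) # L)" by force
    then have "X e = s" "s \<in> {1,-1}"
      using X(2) \<open>set ((a,1) # L) \<subseteq> S\<close> by (auto simp: S_def)
    then show "e \<in> supp X" by (auto simp: supp_def pos_part_def neg_part_def)
  qed
  finally have "T = supp X"
    using T card_supp_circuit[OF X(1)]
    by (intro card_subset_eq) (auto intro: card_ge_0_finite)
  then show "T \<in> supp ` circuits (lawrence r n A)" using X(1) by blast
qed

lemma om_rank_lawrence:
  assumes "r \<le> n"
  shows "om_rank (lawrence r n A) = r"
  unfolding om_rank_def
proof (rule Max_eqI)
  let ?indep = "\<lambda>I. I \<subseteq> ground (lawrence r n A) \<and>
    (\<forall>X\<in>circuits (lawrence r n A). \<not> supp X \<subseteq> I)"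
  have g: "ground (lawrence r n A) = {1..n}" by (simp add: lawrence_def)
  have "{card I |I. ?indep I} \<subseteq> card ` Pow {1..n}" by (auto simp: g)
  then show "finite {card I |I. ?indep I}" by (rule finite_subset) auto
  fix m assume "m \<in> {card I |I. ?indep I}"
  then obtain I where I: "m = card I" "?indep I" by auto
  show "m \<le> r"
  proof (rule ccontr)
    assume "\<not> m \<le> r"
    then have "r + 1 \<le> card I" using I(1) by simp
    then obtain T where T: "T \<subseteq> I" "card T = r + 1"
      by (rule obtain_subset_with_card_n)
    have "T \<subseteq> {1..n}" using T(1) I(2) g by blast
    then have "T \<in> supp ` circuits (lawrence r n A)"
      unfolding supp_circuits using T(2) by blast
    then show False using I(2) T(1) by blast
  qed
next
  have "\<not> supp X \<subseteq> {1..r}" if "X \<in> circuits (lawrence r n A)" for X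
    using card_mono[of "{1..r}" "supp X"] card_supp_circuit[OF that] by auto
  then show "r \<in> {card I |I. I \<subseteq> ground (lawrence r n A) \<and>
    (\<forall>X\<in>circuits (lawrence r n A). \<not> supp X \<subseteq> I)}"
    using assms by (intro CollectI exI[of _ "{1..r}"]) (auto simp: lawrence_def)
qed

end

theorem lawrence_oriented_matroidD:
  assumes "lawrence_oriented_matroid r n M"
  shows "oriented_matroid M" "om_rank M = r" "uniform M" "ground M = {1..n}"
    "2 \<le> r \<Longrightarrow> simple M"
proof -
  obtain A where A: "sign_matrix r n A" and M: "M = lawrence r n A" and "r \<le> n"
    using assms by (auto simp: lawrence_oriented_matroid_def)
  show "oriented_matroid M" unfolding M by (rule oriented_matroid_lawrence[OF A])
  show rk: "om_rank M = r" unfolding M by (rule om_rank_lawrence[OF A \<open>r \<le> n\<close>])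
  show g: "ground M = {1..n}" by (simp add: M lawrence_def)
  show "uniform M"
    using supp_circuits[OF A] unfolding uniform_def rk g by (simp flip: M)
  show "simple M" if "2 \<le> r"
    using that card_supp_circuit[OF A] by (simp add: simple_def M)
qed

theorem lawrence_oriented_matroid_alternating:
  "r \<le> n \<Longrightarrow> lawrence_oriented_matroid r n (alternating r n)"
  unfolding lawrence_oriented_matroid_def alternating_eq_lawrence
  by (auto simp: sign_matrix_def)

end

theory Submission
  imports Defs
begin

text \<open>
  Reorienting a Lawrence oriented matroid by \<open>R\<close> turns every circuit into a list of signs, and
  \<open>k\<close>-neighborliness says exactly that each of these lists has a sum of absolute value at most
  \<open>d = r - 1 - 2k\<close> (\<open>neighborly_iff_balanced\<close>). Write \<open>F(m, N, d)\<close> for the largest number of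
  sets \<open>R\<close> with this property when circuits have \<open>m = r + 1\<close> elements and there are \<open>N\<close> columns.
  Deleting or contracting the first element of a Lawrence oriented matroid gives a Lawrence oriented
  matroid again, which makes induction on the leading columns possible.

  The engine is a recursion that comes from the first two columns \<open>x, y\<close>. They are inseparable:
  exchanging \<open>x\<close> and \<open>y\<close> in a circuit through one of them gives a circuit, and in circuits through
  both their relative sign is always the same. Comparing the four ways to extend a set \<open>P\<close> of
  later columns by \<open>x\<close> and \<open>y\<close> yields (\<open>num_balanced_inseparable_pair\<close>)

    \<open>F(m, N, d) \<le> F(m-2, N-2, d) + F(m-1, N-1, d-1) + F(m-1, N-2, d-1)\<close>,

  where the terms come from contracting \<open>x\<close> and \<open>y\<close>, contracting \<open>x\<close>, and contracting \<open>x\<close> while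
  deleting \<open>y\<close>. The recursion preserves \<open>2 \<Sum>\<^sub>j\<^sub>\<le>\<^sub>d (N-1 choose j)\<close>,
  by Pascal's rule. It bottoms out in two cases: \<open>k = 0\<close>, where acyclic reorientations are counted by
  deletion and contraction (\<open>num_acyclic\<close>), and \<open>d = 0\<close>, where a parity argument shows that at most
  two sets are left (\<open>num_rigid\<close>). For \<open>r = 9\<close>, \<open>k = 3\<close>, \<open>d = 2\<close> this gives the bound
  \<open>n^2 - n + 2\<close> as soon as \<open>n \<ge> 13\<close> (\<open>num_balanced_upper\<close>).

  For \<open>n = 12\<close> the last term of the recursion has only two elements more than its rank and lies outside
  the range of the binomial bound. For that term the sum conditions say that a walk with steps
  \<open>\<plusminus>1\<close> stays in a strip of width two; there are few such walks (\<open>num_corank2\<close>), and the recursion then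
  gives the bound \<open>198\<close> (\<open>num_corank3\<close>).

  Both numbers are attained by the alternating oriented matroid. A set whose indicator function changes
  value at most \<open>d\<close> times along \<open>1, \<dots>, n\<close> is always admissible (\<open>balanced_few_changes\<close>), which accounts for
  \<open>n^2 - n + 2\<close> sets. For \<open>n = 12\<close> the indicator functions that are constant on the pairs
  \<open>{1,2}, {3,4}, \<dots>\<close> or on the pairs \<open>{2,3}, \<dots>, {12,1}\<close> are admissible too (\<open>balanced_pairs\<close>,
  \<open>balanced_cyclic_pairs\<close>), and they add the missing \<open>64\<close>.
\<close>

section \<open>Sign sums of reoriented circuits\<close>

definition sgn_at :: "nat set \<Rightarrow> nat \<Rightarrow> int" where
  "sgn_at R x = (if x \<in> R then -1 else 1)"

definition bal :: "nat set \<Rightarrow> (nat \<times> int) list \<Rightarrow> int" where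
  "bal R L = (\<Sum>(x,s)\<leftarrow>L. s * sgn_at R x)"

text \<open>
  Circuits are the signed lists of \<^const>\<open>chain\<close>. Keeping the first row \<open>i\<close> and the first column \<open>a\<close>
  variable makes the class closed under the minors needed below: deleting column \<open>a\<close> raises \<open>a\<close>, contracting
  it raises both \<open>i\<close> and \<open>a\<close> and lowers the circuit size \<open>m\<close>. The bound \<open>d\<close> is an integer because
  contraction lowers it, eventually below zero, where a single circuit excludes every set.
\<close>

definition is_circuit :: "(nat \<Rightarrow> nat \<Rightarrow> int) \<Rightarrow> nat \<Rightarrow> nat \<Rightarrow> nat \<Rightarrow> nat \<Rightarrow> (nat \<times> int) list \<Rightarrow> bool" where
  "is_circuit A n i m a L \<longleftrightarrow> chain A i L \<and> length L = m \<and> set L \<subseteq> {a..n} \<times> {1,-1}"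

definition balanced :: "(nat \<Rightarrow> nat \<Rightarrow> int) \<Rightarrow> nat \<Rightarrow> nat \<Rightarrow> nat \<Rightarrow> nat \<Rightarrow> int \<Rightarrow> nat set \<Rightarrow> bool" where
  "balanced A n i m a d R \<longleftrightarrow> (\<forall>L. is_circuit A n i m a L \<longrightarrow> \<bar>bal R L\<bar> \<le> d)"

definition num_balanced :: "(nat \<Rightarrow> nat \<Rightarrow> int) \<Rightarrow> nat \<Rightarrow> nat \<Rightarrow> nat \<Rightarrow> nat \<Rightarrow> int \<Rightarrow> nat" where
  "num_balanced A n i m a d = card {R. R \<subseteq> {a..n} \<and> balanced A n i m a d R}"

lemma sgn_at_cases: "sgn_at R x = 1 \<or> sgn_at R x = -1"
  by (auto simp: sgn_at_def)

lemma bal_Nil [simp]: "bal R [] = 0"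
  and bal_Cons [simp]: "bal R ((x,s) # L) = s * sgn_at R x + bal R L"
  by (simp_all add: bal_def)

lemma bal_cong:
  assumes "\<And>x. x \<in> fst ` set L \<Longrightarrow> x \<in> R \<longleftrightarrow> x \<in> R'"
  shows "bal R L = bal R' L"
  using assms by (induction L) (auto simp: sgn_at_def)

lemma num_balanced_eq_sum:
  "num_balanced A n i m a d = (\<Sum>R\<in>Pow {a..n}. of_bool (balanced A n i m a d R))"
proof -
  have "{R. R \<subseteq> {a..n} \<and> balanced A n i m a d R} = {R \<in> Pow {a..n}. balanced A n i m a d R}"
    by auto
  then show ?thesis by (simp add: num_balanced_def Int_def)
qed

lemma of_bool_mono: "(P \<Longrightarrow> Q) \<Longrightarrow> of_bool P \<le> (of_bool Q :: 'a :: linordered_semidom)"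
  by auto

lemma sum_Pow_insert:
  fixes f :: "'a set \<Rightarrow> nat"
  assumes "finite D" "x \<notin> D"
  shows "(\<Sum>R\<in>Pow (insert x D). f R) = (\<Sum>P\<in>Pow D. f P + f (insert x P))"
proof -
  have inj: "inj_on (insert x) (Pow D)"
    using assms(2) by (intro inj_onI) (auto simp: insert_ident)
  have "(\<Sum>R\<in>Pow (insert x D). f R) = sum f (Pow D) + sum f (insert x ` Pow D)"
    unfolding Pow_insert by (intro sum.union_disjoint) (use assms in auto)
  then show ?thesis by (simp add: sum.reindex[OF inj] sum.distrib)
qed

lemma num_balanced_split:
  assumes "a \<le> n"
  shows "num_balanced A n i m a d = (\<Sum>P\<in>Pow {Suc a..n}.
    of_bool (balanced A n i m a d P) + of_bool (balanced A n i m a d (insert a P)))"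
proof -
  have "{a..n} = insert a {Suc a..n}" using assms by auto
  then show ?thesis
    unfolding num_balanced_eq_sum by (simp only:) (rule sum_Pow_insert; simp)
qed

lemma is_circuit_mono:
  assumes "is_circuit A n i m b L" "a \<le> b"
  shows "is_circuit A n i m a L"
  using assms unfolding is_circuit_def by fastforce

lemma circuit_tail:
  assumes "is_circuit A n i m a ((z,u) # K)"
  shows "fst ` set K \<subseteq> {Suc z..n}"
proof
  fix x assume "x \<in> fst ` set K"
  then obtain s where s: "(x,s) \<in> set K" by auto
  have "x \<le> n" using assms s by (auto simp: is_circuit_def)
  moreover have "z < x"
    using chain_sorted[of A i "(z,u) # K"] assms s by (auto simp: is_circuit_def)
  ultimately show "x \<in> {Suc z..n}" by simp
qed

lemma balanced_mono:
  assumes "balanced A n i m a d R" "a \<le> b"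
  shows "balanced A n i m b d R"
  using assms is_circuit_mono unfolding balanced_def by blast

lemma balanced_cong:
  assumes "\<And>x. a \<le> x \<Longrightarrow> x \<in> R \<longleftrightarrow> x \<in> R'"
  shows "balanced A n i m a d R \<longleftrightarrow> balanced A n i m a d R'"
proof -
  have "bal R L = bal R' L" if "is_circuit A n i m a L" for L
    by (rule bal_cong) (use that assms in \<open>auto simp: is_circuit_def\<close>)
  then show ?thesis by (auto simp: balanced_def)
qed

definition binomial_sum :: "nat \<Rightarrow> nat \<Rightarrow> nat" where
  "binomial_sum N d = (\<Sum>j\<le>d. N choose j)"

lemma binomial_sum_0 [simp]: "binomial_sum N 0 = 1"
  by (simp add: binomial_sum_def)

lemma binomial_sum_zero [simp]: "binomial_sum 0 d = 1"
  by (cases d) (simp_all add: binomial_sum_def sum.atMost_Suc_shift del: sum.atMost_Suc)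

lemma binomial_sum_Suc: "binomial_sum (Suc N) (Suc d) = binomial_sum N (Suc d) + binomial_sum N d"
  unfolding binomial_sum_def sum.atMost_Suc_shift[of _ d] by (simp add: sum.distrib)

section \<open>Walks in a strip of width two\<close>

text \<open>
  A step from \<open>u\<close> to \<open>u + y\<close> with \<open>y = \<plusminus>1\<close> satisfies this condition iff both ends lie in
  \<open>{h - 1, h, h + 1}\<close>: its midpoint \<open>u + y/2\<close> has distance \<open>1/2\<close> from \<open>h\<close>. This is the form in which
  the sign sums produce the condition.
\<close>

definition step_ok :: "int \<Rightarrow> int \<Rightarrow> int \<Rightarrow> bool" where
  "step_ok h u y \<longleftrightarrow> \<bar>2 * u + y - 2 * h\<bar> \<le> 1"

lemma step_ok_simps [simp]:
  "step_ok h h 1" "step_ok h h (-1)" "step_ok h (h - 1) 1" "step_ok h (h + 1) (-1)"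
  "\<not> step_ok h (h - 1) (-1)" "\<not> step_ok h (h + 1) 1"
  by (auto simp: step_ok_def)

fun walks :: "int \<Rightarrow> nat \<Rightarrow> int \<Rightarrow> int \<Rightarrow> nat" where
  "walks h 0 u v = of_bool (u = v)"
| "walks h (Suc m) u v =
     (if step_ok h u 1 then walks h m (u + 1) v else 0) +
     (if step_ok h u (-1) then walks h m (u - 1) v else 0)"

text \<open>
  The recursion in \<^const>\<open>walks\<close> removes the first step of a walk from \<open>u\<close> to \<open>v\<close>. A two-ended walk
  extends at either end, so the same number must also obey the recursion that removes the last step.
\<close>

lemma walks_last_step:
  "walks h (Suc m) u v =
     (if step_ok h v 1 then walks h m u (v + 1) else 0) +
     (if step_ok h v (-1) then walks h m u (v - 1) else 0)"
proof (induction m arbitrary: u)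
  case 0
  then show ?case by (auto simp: step_ok_def)
next
  case (Suc m)
  show ?case
    unfolding walks.simps(2)[of h "Suc m" u v] Suc.IH walks.simps(2)[of h m u] by simp
qed

text \<open>
  In a strip of width two every visit to the centre \<open>h\<close> leaves two choices, and the next step returns there.
\<close>

lemma walks_centre: "walks h (2 * j) h h = 2 ^ j"
  by (induction j) auto

lemma walks_across:
  "walks h (2 * j + 2) (h - 1) (h + 1) = 2 ^ j" "walks h (2 * j + 2) (h + 1) (h - 1) = 2 ^ j"
proof -
  have "walks h (2 * j + 2) (h - 1) (h + 1) = walks h (Suc (2 * j)) h (h + 1)"
    "walks h (2 * j + 2) (h + 1) (h - 1) = walks h (Suc (2 * j)) h (h - 1)" by auto
  then show "walks h (2 * j + 2) (h - 1) (h + 1) = 2 ^ j" "walks h (2 * j + 2) (h + 1) (h - 1) = 2 ^ j"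
    unfolding walks_last_step using walks_centre by auto
qed

text \<open>
  The list \<open>ys\<close> describes a walk that is built from both ends towards a meeting point: an entry with
  \<open>q = 1\<close> moves the left end \<open>u\<close>, any other entry moves the right end \<open>v\<close>.
\<close>

fun two_ended :: "int \<Rightarrow> int \<Rightarrow> int \<Rightarrow> int list \<Rightarrow> int list \<Rightarrow> bool" where
  "two_ended h u v (q # qs) (y # ys) \<longleftrightarrow>
     (if q = 1 then step_ok h u y \<and> two_ended h (u + y) v qs ys
      else step_ok h v y \<and> two_ended h u (v + y) qs ys)"
| "two_ended h u v qs ys \<longleftrightarrow> u = v"

definition sign_lists :: "nat \<Rightarrow> int list set" where
  "sign_lists N = {ys. set ys \<subseteq> {1,-1} \<and> length ys = N}"

lemma finite_sign_lists [simp]: "finite (sign_lists N)"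
  unfolding sign_lists_def by (rule finite_lists_length_eq) simp

text \<open>
  The number of two-ended walks does not depend on the order in which the two ends move.
\<close>

lemma card_two_ended: "card {ys \<in> sign_lists (length qs). two_ended h u v qs ys} \<le> walks h (length qs) u v"
proof (induction qs arbitrary: u v)
  case Nil
  have "{ys \<in> sign_lists (length []). two_ended h u v [] ys} = (if u = v then {[]} else {})"
    by (auto simp: sign_lists_def)
  then show ?case by simp
next
  case (Cons q qs)
  define T where "T u v = {ys \<in> sign_lists (length qs). two_ended h u v qs ys}" for u v
  have fin: "finite (T u v)" for u v by (simp add: T_def)
  have IH: "card (T u v) \<le> walks h (length qs) u v" for u v using Cons.IH by (simp add: T_def)
  have im: "card ((#) y ` T u v) \<le> walks h (length qs) u v" for y u v
    using card_image_le[OF fin, of "(#) y" u v] IH[of u v] by simp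
  show ?case
  proof (cases "q = 1")
    case True
    have "{ys \<in> sign_lists (length (q # qs)). two_ended h u v (q # qs) ys} \<subseteq>
      (if step_ok h u 1 then (#) 1 ` T (u + 1) v else {}) \<union>
      (if step_ok h u (-1) then (#) (-1) ` T (u - 1) v else {})" (is "_ \<subseteq> ?U \<union> ?V")
      using True by (auto simp: T_def sign_lists_def length_Suc_conv)
    then have "card {ys \<in> sign_lists (length (q # qs)). two_ended h u v (q # qs) ys} \<le> card (?U \<union> ?V)"
      using fin by (intro card_mono) auto
    also have "\<dots> \<le> card ?U + card ?V" by (rule card_Un_le)
    also have "\<dots> \<le> walks h (length (q # qs)) u v"
      using im[of 1 "u + 1" v] im[of "-1" "u - 1" v] by simp
    finally show ?thesis .
  next
    case False
    have "{ys \<in> sign_lists (length (q # qs)). two_ended h u v (q # qs) ys} \<subseteq>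
      (if step_ok h v 1 then (#) 1 ` T u (v + 1) else {}) \<union>
      (if step_ok h v (-1) then (#) (-1) ` T u (v - 1) else {})" (is "_ \<subseteq> ?U \<union> ?V")
      using False by (auto simp: T_def sign_lists_def length_Suc_conv)
    then have "card {ys \<in> sign_lists (length (q # qs)). two_ended h u v (q # qs) ys} \<le> card (?U \<union> ?V)"
      using fin by (intro card_mono) auto
    also have "\<dots> \<le> card ?U + card ?V" by (rule card_Un_le)
    also have "\<dots> \<le> walks h (length (q # qs)) u v"
      unfolding list.size(4) add_0_right One_nat_def add_Suc_right walks_last_step
      using im[of 1 u "v + 1"] im[of "-1" u "v - 1"] by simp
    finally show ?thesis .
  qed
qed

fun dot :: "int list \<Rightarrow> int list \<Rightarrow> int" where
  "dot (q # qs) (y # ys) = q * y + dot qs ys"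
| "dot qs ys = 0"

text \<open>
  \<open>S\<close> is the sum of the entries before the current position. In a system with two elements more than
  its rank every circuit omits one element, and its sum is of the form \<open>S - q * dot qs ys\<close>, with \<open>q\<close> the
  entry at the omitted position.
\<close>

fun windows_balanced :: "int \<Rightarrow> int list \<Rightarrow> int list \<Rightarrow> bool" where
  "windows_balanced S (q # qs) (y # ys) \<longleftrightarrow> \<bar>S - q * dot qs ys\<bar> \<le> 1 \<and> windows_balanced (S + y) qs ys"
| "windows_balanced S qs ys \<longleftrightarrow> True"

text \<open>
  Let \<open>2h\<close> be the value of the whole \<open>dot\<close> product. The left end has moved by the sum \<open>p\<close> of the
  earlier entries with \<open>q = 1\<close>, the right end starts at \<open>2h\<close> and has moved by the sum \<open>q\<close> of the other
  earlier entries. Then twice the midpoint of the next step, minus \<open>2h\<close>, is the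
  sum for the circuit that omits the current position; the ends meet because \<open>2h\<close> is the total displacement.
\<close>

lemma two_ended_of_windows:
  assumes "windows_balanced (p + q) qs ys" "2 * h = p - q + dot qs ys" "length ys = length qs" "set qs \<subseteq> {1,-1}"
  shows "two_ended h p (2 * h + q) qs ys"
  using assms
proof (induction qs ys arbitrary: p q rule: dot.induct)
  case (1 c qs y ys)
  show ?case
  proof (cases "c = 1")
    case True
    have "two_ended h (p + y) (2 * h + q) qs ys"
      by (rule 1(1)) (use 1(2-) True in \<open>auto simp: algebra_simps\<close>)
    moreover have eq: "2 * p + y - 2 * h = p + q - dot qs ys" using 1(3) True by simp
    have "step_ok h p y" unfolding step_ok_def eq using 1(2) True by simp
    ultimately show ?thesis using True by simp
  next
    case False
    then have c: "c = -1" using 1 by auto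
    have "two_ended h p (2 * h + (q + y)) qs ys"
      by (rule 1(1)) (use 1(2-) c in \<open>auto simp: algebra_simps\<close>)
    moreover have eq: "2 * (2 * h + q) + y - 2 * h = p + q + dot qs ys" using 1(3) c by simp
    have "step_ok h (2 * h + q) y" unfolding step_ok_def eq using 1(2) c by simp
    ultimately show ?thesis using c by (simp add: add.assoc)
  qed
qed auto

lemma dot_parity:
  assumes "set qs \<subseteq> {1,-1}" "set ys \<subseteq> {1,-1}" "length ys = length qs"
  shows "even (dot qs ys) \<longleftrightarrow> even (length qs)"
  using assms
proof (induction qs ys rule: dot.induct)
  case (1 q qs y ys)
  then have "odd (q * y)" by auto
  with 1 show ?case by auto
qed auto

text \<open>
  The walk leads from \<open>0\<close> to \<open>2h\<close> within \<open>{h - 1, h, h + 1}\<close>, so \<open>h \<in> {-1, 0, 1}\<close>. The three cases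
  contribute \<open>2^j\<close>, \<open>2^(j+1)\<close> and \<open>2^j\<close> walks.
\<close>

lemma card_windows_balanced:
  assumes "set qs \<subseteq> {1,-1}" "length qs = 2 * j + 2"
  shows "card {ys \<in> sign_lists (2 * j + 2). windows_balanced 0 qs ys} \<le> 2 ^ (j + 2)"
proof -
  let ?T = "\<lambda>h. {ys \<in> sign_lists (length qs). two_ended h 0 (2 * h) qs ys}"
  have "{ys \<in> sign_lists (2 * j + 2). windows_balanced 0 qs ys} \<subseteq> ?T 0 \<union> ?T 1 \<union> ?T (-1)"
  proof
    fix ys assume ys: "ys \<in> {ys \<in> sign_lists (2 * j + 2). windows_balanced 0 qs ys}"
    then have l: "length ys = length qs" "set ys \<subseteq> {1,-1}"
      using assms(2) by (auto simp: sign_lists_def)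
    have "even (dot qs ys)" using dot_parity[OF assms(1) l(2,1)] assms(2) by simp
    then obtain h where h: "dot qs ys = 2 * h" by blast
    have te: "two_ended h 0 (2 * h) qs ys"
      using two_ended_of_windows[of 0 0 qs ys h] ys l h assms(1) by simp
    obtain q qs' y ys' where "qs = q # qs'" "ys = y # ys'"
      using l(1) assms(2) by (cases qs; cases ys) auto
    then have "h \<in> {0,1,-1}" using te l(2) by (auto simp: step_ok_def split: if_splits)
    then show "ys \<in> ?T 0 \<union> ?T 1 \<union> ?T (-1)" using te ys assms(2) by auto
  qed
  then have "card {ys \<in> sign_lists (2 * j + 2). windows_balanced 0 qs ys} \<le> card (?T 0 \<union> ?T 1 \<union> ?T (-1))"
    by (intro card_mono) auto
  also have "\<dots> \<le> card (?T 0) + card (?T 1) + card (?T (-1))"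
    by (meson add_le_mono1 card_Un_le le_trans)
  also have "\<dots> \<le> walks 0 (2 * j + 2) 0 0 + walks 1 (2 * j + 2) 0 2 + walks (-1) (2 * j + 2) 0 (-2)"
    using card_two_ended[of qs 0 0 0] card_two_ended[of qs 1 0 2] card_two_ended[of qs "-1" 0 "-2"] assms(2) by simp
  also have "\<dots> = 2 ^ (j + 2)"
    using walks_centre[of 0 "Suc j"] walks_across(1)[of 1 j] walks_across(2)[of "-1" j] by simp
  finally show ?thesis .
qed

lemma dot_map_upt: "dot (map q [p..<N]) (map y [p..<N]) = (\<Sum>x\<in>{p..<N}. q x * y x)"
proof (induction "N - p" arbitrary: p)
  case (Suc d)
  then show ?case by (simp add: upt_conv_Cons sum.atLeast_Suc_lessThan)
qed auto

lemma windows_balanced_map_upt: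
  assumes "\<And>t. p \<le> t \<Longrightarrow> t < N \<Longrightarrow>
    \<bar>S + (\<Sum>x\<in>{p..<t}. y x) - q t * (\<Sum>x\<in>{Suc t..<N}. q x * y x)\<bar> \<le> 1"
  shows "windows_balanced S (map q [p..<N]) (map y [p..<N])"
  using assms
proof (induction "N - p" arbitrary: p S)
  case (Suc d)
  have "windows_balanced (S + y p) (map q [Suc p..<N]) (map y [Suc p..<N])"
  proof (rule Suc.hyps(1))
    fix t assume t: "Suc p \<le> t" "t < N"
    then have "{p..<t} = insert p {Suc p..<t}" by auto
    then show "\<bar>S + y p + (\<Sum>x\<in>{Suc p..<t}. y x) - q t * (\<Sum>x\<in>{Suc t..<N}. q x * y x)\<bar> \<le> 1"
      using Suc.prems[of t] t by simp
  qed (use Suc.hyps(2) in simp)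
  then show ?case
    using Suc.hyps(2) Suc.prems[of p] by (simp add: upt_conv_Cons dot_map_upt)
qed auto

section \<open>Deletion, contraction and inseparable pairs\<close>

text \<open>
  Here \<open>X\<close> and \<open>Y\<close> are the signs of the inseparable elements \<open>x\<close> and \<open>y\<close>, normalised so that circuits
  through both elements see \<open>Y - X\<close>; \<open>Z\<close> collects what the rest of a circuit through just one of them
  contributes, \<open>W\<close> the rest of a circuit through both. On the right are the conditions for
  \<open>M/x/y\<close>, for \<open>M/x\<close> with the two possible signs of \<open>y\<close>, and for \<open>M/x\<close> without \<open>y\<close>. A choice with
  \<open>X \<noteq> Y\<close> allows both signs next to every \<open>z\<close>, hence \<open>\<bar>z\<bar> \<le> d - 1\<close>; a choice with \<open>X = Y\<close> gives
  \<open>\<bar>w\<bar> \<le> d\<close>; combining one of each kind gives the middle value \<open>\<bar>Y + w\<bar> \<le> d - 1\<close>. So every further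
  admissible choice is paid for by a further condition on the right.
\<close>

lemma signed_pair_count:
  fixes g :: "int \<Rightarrow> int \<Rightarrow> bool"
  assumes g: "\<And>X Y. X \<in> {1,-1} \<Longrightarrow> Y \<in> {1,-1} \<Longrightarrow> g X Y \<Longrightarrow>
    (\<forall>z\<in>Z. \<bar>X + z\<bar> \<le> d \<and> \<bar>Y + z\<bar> \<le> d) \<and> (\<forall>w\<in>W. \<bar>Y - X + w\<bar> \<le> d)"
  defines "c \<equiv> (\<forall>z\<in>Z. \<bar>z\<bar> \<le> d - 1)"
  defines "b \<equiv> (\<lambda>Y. c \<and> (\<forall>w\<in>W. \<bar>Y + w\<bar> \<le> d - 1))"
  shows "(of_bool (g 1 1) + of_bool (g 1 (-1)) + of_bool (g (-1) 1) + of_bool (g (-1) (-1)) :: nat) \<le>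
    of_bool (\<forall>w\<in>W. \<bar>w\<bar> \<le> d) + of_bool (b 1) + of_bool (b (-1)) + of_bool c"
proof -
  let ?a = "\<forall>w\<in>W. \<bar>w\<bar> \<le> d"
  have E: "?a" if "g 1 1 \<or> g (-1) (-1)"
    using that g[of 1 1] g[of "-1" "-1"] by auto
  have EE: "c" if "g 1 1" "g (-1) (-1)"
    unfolding c_def using g[OF _ _ that(1)] g[OF _ _ that(2)] by fastforce
  have U1: "c" if "g 1 (-1)" unfolding c_def using g[OF _ _ that] by fastforce
  have U2: "c" if "g (-1) 1" unfolding c_def using g[OF _ _ that] by fastforce
  have UE1: "b (-1)" if "g 1 (-1)" "?a"
    unfolding b_def using U1[OF that(1)] g[OF _ _ that(1)] that(2) by fastforce
  have UE2: "b 1" if "g (-1) 1" "?a"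
    unfolding b_def using U2[OF that(1)] g[OF _ _ that(1)] that(2) by fastforce
  have UU: "?a" if "g 1 (-1)" "g (-1) 1"
    using g[OF _ _ that(1)] g[OF _ _ that(2)] by fastforce
  show ?thesis
    using E EE U1 U2 UE1 UE2 UU
    by (cases "g 1 1"; cases "g 1 (-1)"; cases "g (-1) 1"; cases "g (-1) (-1)") auto
qed

context
  fixes A :: "nat \<Rightarrow> nat \<Rightarrow> int" and n :: nat
  assumes sign: "\<And>i x. A i x = 1 \<or> A i x = -1"
begin

lemma circuit_Cons:
  assumes "is_circuit A n (Suc i) m b ((z,u) # L)" "x < b" "x \<le> n"
  shows "is_circuit A n i (Suc m) x ((x, - (u * A i z * A i x)) # (z,u) # L)"
proof -
  have z: "b \<le> z" and u: "u = 1 \<or> u = -1" using assms(1) by (auto simp: is_circuit_def)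
  then show ?thesis
    using assms sign[of i z] sign[of i x] z u
    by (auto simp: is_circuit_def)
qed

lemma head_cases:
  assumes "is_circuit A n i m a L" "0 < m"
  obtains z u K where "L = (z,u) # K" "a \<le> z" "u = 1 \<or> u = -1"
proof (cases L)
  case (Cons b K)
  obtain z u where "b = (z,u)" by (cases b)
  then show ?thesis using assms Cons by (intro that[of z u K]) (auto simp: is_circuit_def)
qed (use assms in \<open>auto simp: is_circuit_def\<close>)

text \<open>
  A set \<open>P\<close> of later columns is counted twice only if \<open>a\<close> may take either sign, so that a circuit
  through \<open>a\<close> has room for \<open>\<plusminus>1\<close> next to its remaining sum.
\<close>

theorem num_balanced_deletion_contraction:
  assumes "a \<le> n" "2 \<le> m"
  shows "num_balanced A n i m a d \<le>
    num_balanced A n i m (Suc a) d + num_balanced A n (Suc i) (m-1) (Suc a) (d-1)"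
proof -
  have "of_bool (balanced A n i m a d P) + of_bool (balanced A n i m a d (insert a P)) \<le>
    (of_bool (balanced A n i m (Suc a) d P) + of_bool (balanced A n (Suc i) (m-1) (Suc a) (d-1) P) :: nat)"
    if P: "P \<subseteq> {Suc a..n}" for P
  proof -
    have cong: "balanced A n i m (Suc a) d (insert a P) \<longleftrightarrow> balanced A n i m (Suc a) d P"
      by (rule balanced_cong) auto
    have del: "balanced A n i m (Suc a) d P"
      if "balanced A n i m a d P \<or> balanced A n i m a d (insert a P)"
      using that balanced_mono[of A n i m a d _ "Suc a"] cong by auto
    have con: "balanced A n (Suc i) (m-1) (Suc a) (d-1) P"
      if both: "balanced A n i m a d P" "balanced A n i m a d (insert a P)"
      unfolding balanced_def
    proof (intro allI impI)
      fix L assume L: "is_circuit A n (Suc i) (m-1) (Suc a) L"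
      then obtain z u K where z: "L = (z,u) # K" "Suc a \<le> z" "u = 1 \<or> u = -1"
        using L assms(2) by (auto elim!: head_cases)
      define s where "s = - (u * A i z * A i a)"
      have s: "s = 1 \<or> s = -1" using z(3) sign[of i z] sign[of i a] by (auto simp: s_def)
      have "is_circuit A n i m a ((a,s) # L)"
        using circuit_Cons[of i "m-1" "Suc a" z u K a] L z(1) assms by (simp add: s_def)
      then have "\<bar>bal P ((a,s) # L)\<bar> \<le> d" "\<bar>bal (insert a P) ((a,s) # L)\<bar> \<le> d"
        using both by (auto simp: balanced_def simp del: bal_Cons)
      moreover have "a \<notin> P" using P by auto
      moreover have "bal (insert a P) L = bal P L"
        by (rule bal_cong) (use L in \<open>auto simp: is_circuit_def\<close>)
      ultimately show "\<bar>bal P L\<bar> \<le> d - 1"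
        using s by (auto simp: sgn_at_def)
    qed
    show ?thesis using del con by auto
  qed
  then show ?thesis
    unfolding num_balanced_split[OF assms(1)] num_balanced_eq_sum[of A n _ _ "Suc a"]
      sum.distrib[symmetric] by (intro sum_mono) auto
qed

text \<open>
  The first two columns are inseparable because they can only occupy the first two positions of a circuit,
  where row \<open>i\<close> alone relates them to each other and to the third element. The number \<open>lead L\<close>
  is, up to the matrix entry, the sign which a column put in front of \<open>L\<close> receives; multiplying by it
  and by the entries of row \<open>i\<close> brings the sums into the form of \<open>signed_pair_count\<close>.
\<close>

lemma num_balanced_pair_pointwise:
  fixes i :: nat and d :: int
  assumes "Suc a \<le> n" "3 \<le> m" and P: "P \<subseteq> {Suc (Suc a)..n}"
  defines "G \<equiv> (\<lambda>R. of_bool (balanced A n i m a d R) :: nat)"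
  shows "G P + G (insert (Suc a) P) + (G (insert a P) + G (insert a (insert (Suc a) P))) \<le>
    of_bool (balanced A n (Suc (Suc i)) (m-2) (Suc (Suc a)) d P) +
    (of_bool (balanced A n (Suc i) (m-1) (Suc a) (d-1) P) +
     of_bool (balanced A n (Suc i) (m-1) (Suc a) (d-1) (insert (Suc a) P))) +
    of_bool (balanced A n (Suc i) (m-1) (Suc (Suc a)) (d-1) P)"
proof -
  define lead where "lead L = - (snd (hd L) * A i (fst (hd L)))" for L :: "(nat \<times> int) list"
  define Z where "Z = (\<lambda>L. lead L * bal P L) ` {L. is_circuit A n (Suc i) (m-1) (Suc (Suc a)) L}"
  define W where "W = (\<lambda>L. - lead L * bal P (tl L)) ` {L. is_circuit A n (Suc i) (m-1) (Suc a) L \<and> fst (hd L) = Suc a}"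
  \<comment> \<open>the extension of \<open>P\<close> whose signs at the two columns, multiplied by their entries in row \<open>i\<close>,
    are \<open>X\<close> and \<open>Y\<close>\<close>
  define S where "S X Y = P \<union> (if X = A i a then {} else {a}) \<union> (if Y = A i (Suc a) then {} else {Suc a})" for X Y
  define g where "g X Y = balanced A n i m a d (S X Y)" for X Y
  define c where "c \<longleftrightarrow> (\<forall>z\<in>Z. \<bar>z\<bar> \<le> d - 1)"
  define b where "b Y \<longleftrightarrow> c \<and> (\<forall>w\<in>W. \<bar>Y + w\<bar> \<le> d - 1)" for Y
  have nP: "a \<notin> P" "Suc a \<notin> P" using P by auto
  have lead: "lead L = 1 \<or> lead L = -1" if circ: "is_circuit A n (Suc i) (m-1) b' L" for L b'
  proof -
    obtain z u K where "L = (z,u) # K" "u = 1 \<or> u = -1"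
      using circ assms(2) by (auto elim!: head_cases)
    then show ?thesis using sign[of i z] by (auto simp: lead_def)
  qed
  have abs_lead: "\<bar>lead L * w\<bar> = \<bar>w\<bar>" if "is_circuit A n (Suc i) (m-1) b' L" for L b' w
    using lead[OF that] by auto
  have sgn_S: "A i a * sgn_at (S X Y) a = X" "A i (Suc a) * sgn_at (S X Y) (Suc a) = Y"
    if "X \<in> {1,-1}" "Y \<in> {1,-1}" for X Y
    using that nP sign[of i a] sign[of i "Suc a"] by (auto simp: S_def sgn_at_def)
  have bal_S: "bal (S X Y) L = bal P L" if "fst ` set L \<subseteq> {Suc (Suc a)..n}" for X Y L
    by (rule bal_cong) (use that in \<open>auto simp: S_def\<close>)
  have pre: "\<bar>A i v * sgn_at R v * lead L + bal R L\<bar> \<le> d"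
    if R: "balanced A n i m a d R" and L: "is_circuit A n (Suc i) (m-1) b' L" and v: "a \<le> v" "v < b'" "v \<le> n"
    for R L b' v
  proof -
    obtain z u K where z: "L = (z,u) # K" using L assms(2) by (auto elim!: head_cases)
    have "is_circuit A n i m v ((v, A i v * lead L) # L)"
      using circuit_Cons[of i "m-1" b' z u K v] L z v assms(2) by (simp add: lead_def mult_ac)
    then have "is_circuit A n i m a ((v, A i v * lead L) # L)"
      by (rule is_circuit_mono) (use v in auto)
    then have "\<bar>bal R ((v, A i v * lead L) # L)\<bar> \<le> d" using R by (auto simp: balanced_def simp del: bal_Cons)
    then show ?thesis by (simp add: mult_ac)
  qed
  have g: "(\<forall>z\<in>Z. \<bar>X + z\<bar> \<le> d \<and> \<bar>Y + z\<bar> \<le> d) \<and> (\<forall>w\<in>W. \<bar>Y - X + w\<bar> \<le> d)"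
    if XY: "X \<in> {1,-1}" "Y \<in> {1,-1}" and "g X Y" for X Y
  proof (intro conjI ballI)
    have G: "balanced A n i m a d (S X Y)" using that by (simp add: g_def)
    fix z assume "z \<in> Z"
    then obtain L where L: "is_circuit A n (Suc i) (m-1) (Suc (Suc a)) L" "z = lead L * bal P L"
      by (auto simp: Z_def)
    have B: "bal (S X Y) L = bal P L" using L(1) by (intro bal_S) (auto simp: is_circuit_def)
    have "\<bar>X * lead L + bal P L\<bar> \<le> d" "\<bar>Y * lead L + bal P L\<bar> \<le> d"
      using pre[OF G L(1), of a] pre[OF G L(1), of "Suc a"] assms(1) sgn_S[OF XY] B by auto
    then show "\<bar>X + z\<bar> \<le> d" "\<bar>Y + z\<bar> \<le> d"
      using lead[OF L(1)] L(2) by auto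
  next
    have G: "balanced A n i m a d (S X Y)" using that by (simp add: g_def)
    fix w assume "w \<in> W"
    then obtain L where L: "is_circuit A n (Suc i) (m-1) (Suc a) L" "fst (hd L) = Suc a"
       "w = - lead L * bal P (tl L)" by (auto simp: W_def)
    obtain u K where K: "L = (Suc a,u) # K" "u = 1 \<or> u = -1"
      using L(1,2) assms(2) by (auto elim!: head_cases)
    have "fst ` set K \<subseteq> {Suc (Suc a)..n}"
      using circuit_tail L(1) unfolding K(1) .
    then have B: "bal (S X Y) K = bal P K" by (rule bal_S)
    have u: "u = - lead L * A i (Suc a)"
      using K sign[of i "Suc a"] by (auto simp: lead_def)
    have "\<bar>X * lead L + (u * sgn_at (S X Y) (Suc a) + bal P K)\<bar> \<le> d"
      using pre[OF G L(1), of a] assms(1) sgn_S(1)[OF XY] B K(1) by auto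
    moreover have "u * sgn_at (S X Y) (Suc a) = - lead L * Y"
      using sgn_S(2)[OF XY] u by (simp add: mult.assoc)
    ultimately have "\<bar>X * lead L - lead L * Y + bal P K\<bar> \<le> d" by simp
    then show "\<bar>Y - X + w\<bar> \<le> d"
      using lead[OF L(1)] L(3) K(1) by auto
  qed
  have count: "(of_bool (g 1 1) + of_bool (g 1 (-1)) + of_bool (g (-1) 1) + of_bool (g (-1) (-1)) :: nat) \<le>
    of_bool (\<forall>w\<in>W. \<bar>w\<bar> \<le> d) + of_bool (b 1) + of_bool (b (-1)) + of_bool c"
    unfolding b_def c_def by (rule signed_pair_count[OF g])
  have ca: "balanced A n (Suc (Suc i)) (m-2) (Suc (Suc a)) d P" if "\<forall>w\<in>W. \<bar>w\<bar> \<le> d"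
    unfolding balanced_def
  proof (intro allI impI)
    fix K assume K: "is_circuit A n (Suc (Suc i)) (m-2) (Suc (Suc a)) K"
    then obtain z u K' where z: "K = (z,u) # K'"
      using K assms(2) by (auto elim!: head_cases)
    obtain v where v: "is_circuit A n (Suc i) (m-1) (Suc a) ((Suc a, v) # K)"
      using circuit_Cons[of "Suc i" "m-2" "Suc (Suc a)" z u K' "Suc a"] K z assms(1,2)
      by (auto simp: Suc_diff_Suc numeral_2_eq_2)
    then have "- lead ((Suc a, v) # K) * bal P K \<in> W"
      unfolding W_def by (intro image_eqI[of _ _ "(Suc a, v) # K"]) auto
    with that abs_lead[OF v] show "\<bar>bal P K\<bar> \<le> d" by fastforce
  qed
  have cc: "balanced A n (Suc i) (m-1) (Suc (Suc a)) (d-1) P" if c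
    unfolding balanced_def
  proof (intro allI impI)
    fix L assume L: "is_circuit A n (Suc i) (m-1) (Suc (Suc a)) L"
    then have "lead L * bal P L \<in> Z" by (auto simp: Z_def)
    with that abs_lead[OF L] show "\<bar>bal P L\<bar> \<le> d - 1" by (auto simp: c_def)
  qed
  have cb: "balanced A n (Suc i) (m-1) (Suc a) (d-1) (S (A i a) Y)" if bY: "b Y" and Y: "Y \<in> {1,-1}" for Y
    unfolding balanced_def
  proof (intro allI impI)
    fix L assume L: "is_circuit A n (Suc i) (m-1) (Suc a) L"
    obtain z u K where K: "L = (z,u) # K" "Suc a \<le> z" "u = 1 \<or> u = -1"
      using L assms(2) by (auto elim!: head_cases)
    have tl: "fst ` set K \<subseteq> {Suc z..n}"
      using circuit_tail L unfolding K(1) .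
    show "\<bar>bal (S (A i a) Y) L\<bar> \<le> d - 1"
    proof (cases "z = Suc a")
      case True
      have "- lead L * bal P K \<in> W" unfolding W_def
        by (intro image_eqI[of _ _ L]) (use L K True in auto)
      then have w: "\<bar>Y - lead L * bal P K\<bar> \<le> d - 1" using bY by (fastforce simp: b_def)
      have "u * sgn_at (S (A i a) Y) (Suc a) = - lead L * Y"
        using sgn_S(2)[of "A i a" Y] Y sign[of i a] sign[of i "Suc a"] K(1) True by (auto simp: lead_def)
      moreover have "bal (S (A i a) Y) K = bal P K" using tl True by (intro bal_S) auto
      ultimately have "bal (S (A i a) Y) L = - lead L * Y + bal P K" using K(1) True by simp
      then show ?thesis using w lead[OF L] by auto
    next
      case False
      then have 1: "fst ` set L \<subseteq> {Suc (Suc a)..n}" using tl K L by (auto simp: is_circuit_def)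
      then have "is_circuit A n (Suc i) (m-1) (Suc (Suc a)) L"
        using L by (auto simp: is_circuit_def)
      then have "\<bar>bal P L\<bar> \<le> d - 1" using cc bY by (auto simp: b_def balanced_def)
      then show ?thesis using bal_S[OF 1] by simp
    qed
  qed
  have S: "S (A i a) (A i (Suc a)) = P" "S (A i a) (- A i (Suc a)) = insert (Suc a) P"
    "S (- A i a) (A i (Suc a)) = insert a P" "S (- A i a) (- A i (Suc a)) = insert a (insert (Suc a) P)"
    using sign[of i a] sign[of i "Suc a"] by (auto simp: S_def)
  have GS: "G (S X Y) = of_bool (g X Y)" for X Y by (simp add: G_def g_def)
  have "G P + G (insert (Suc a) P) + (G (insert a P) + G (insert a (insert (Suc a) P))) =
      of_bool (g (A i a) (A i (Suc a))) + of_bool (g (A i a) (- A i (Suc a))) +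
      (of_bool (g (- A i a) (A i (Suc a))) + of_bool (g (- A i a) (- A i (Suc a))))"
    using GS[of "A i a" "A i (Suc a)"] GS[of "A i a" "- A i (Suc a)"]
      GS[of "- A i a" "A i (Suc a)"] GS[of "- A i a" "- A i (Suc a)"] by (simp only: S)
  also have "\<dots> = of_bool (g 1 1) + of_bool (g 1 (-1)) + of_bool (g (-1) 1) + of_bool (g (-1) (-1))"
    using sign[of i a] sign[of i "Suc a"] by (elim disjE) simp_all
  finally have lhs: "G P + G (insert (Suc a) P) + (G (insert a P) + G (insert a (insert (Suc a) P))) =
      of_bool (g 1 1) + of_bool (g 1 (-1)) + of_bool (g (-1) 1) + of_bool (g (-1) (-1))" .
  have rhs: "of_bool (b 1) + of_bool (b (-1)) \<le>
     (of_bool (balanced A n (Suc i) (m-1) (Suc a) (d-1) P) +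
     of_bool (balanced A n (Suc i) (m-1) (Suc a) (d-1) (insert (Suc a) P)) :: nat)"
  proof -
    have "balanced A n (Suc i) (m-1) (Suc a) (d-1) P" if "b (A i (Suc a))"
      using cb[OF that] sign[of i "Suc a"] by (simp add: S)
    moreover have "balanced A n (Suc i) (m-1) (Suc a) (d-1) (insert (Suc a) P)" if "b (- A i (Suc a))"
      using cb[OF that] sign[of i "Suc a"] by (auto simp: S)
    ultimately show ?thesis
      using sign[of i "Suc a"] by (elim disjE) auto
  qed
  have la: "of_bool (\<forall>w\<in>W. \<bar>w\<bar> \<le> d) \<le>
      (of_bool (balanced A n (Suc (Suc i)) (m-2) (Suc (Suc a)) d P) :: nat)"
    by (rule of_bool_mono) (rule ca)
  have lc: "of_bool c \<le> (of_bool (balanced A n (Suc i) (m-1) (Suc (Suc a)) (d-1) P) :: nat)"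
    by (rule of_bool_mono) (rule cc)
  show ?thesis
    unfolding lhs using count rhs la lc by linarith
qed

theorem num_balanced_inseparable_pair:
  assumes "Suc a \<le> n" "3 \<le> m"
  shows "num_balanced A n i m a d \<le> num_balanced A n (Suc (Suc i)) (m-2) (Suc (Suc a)) d +
    num_balanced A n (Suc i) (m-1) (Suc a) (d-1) + num_balanced A n (Suc i) (m-1) (Suc (Suc a)) (d-1)"
proof -
  let ?G = "\<lambda>R. of_bool (balanced A n i m a d R) :: nat"
  have ins: "{Suc a..n} = insert (Suc a) {Suc (Suc a)..n}" using assms by auto
  have "num_balanced A n i m a d = (\<Sum>P\<in>Pow {Suc (Suc a)..n}.
     ?G P + ?G (insert (Suc a) P) + (?G (insert a P) + ?G (insert a (insert (Suc a) P))))"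
    unfolding num_balanced_split[OF Suc_leD[OF assms(1)]] ins
    by (subst sum_Pow_insert) (auto intro!: sum.cong simp: insert_commute)
  also have "\<dots> \<le> (\<Sum>P\<in>Pow {Suc (Suc a)..n}.
    of_bool (balanced A n (Suc (Suc i)) (m-2) (Suc (Suc a)) d P) +
    (of_bool (balanced A n (Suc i) (m-1) (Suc a) (d-1) P) +
     of_bool (balanced A n (Suc i) (m-1) (Suc a) (d-1) (insert (Suc a) P))) +
    of_bool (balanced A n (Suc i) (m-1) (Suc (Suc a)) (d-1) P))"
    using num_balanced_pair_pointwise[OF assms] by (intro sum_mono) auto
  also have "\<dots> = num_balanced A n (Suc (Suc i)) (m-2) (Suc (Suc a)) d +
    num_balanced A n (Suc i) (m-1) (Suc a) (d-1) + num_balanced A n (Suc i) (m-1) (Suc (Suc a)) (d-1)"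
    using num_balanced_split[OF assms(1), of A "Suc i" "m-1" "d-1"]
    by (simp only: sum.distrib num_balanced_eq_sum[of A n _ _ "Suc (Suc a)"])
  finally show ?thesis .
qed

section \<open>The bound by binomial coefficients\<close>

lemma num_balanced_le_power: "num_balanced A n i m a d \<le> 2 ^ (Suc n - a)"
proof -
  have "num_balanced A n i m a d \<le> card (Pow {a..n})"
    unfolding num_balanced_def by (rule card_mono) auto
  then show ?thesis by (simp add: card_Pow)
qed

text \<open>
  With \<open>d = m - 2\<close> the sum condition only excludes circuits all of whose signs agree, so the sets
  counted here and in \<open>num_acyclic\<close> are those with an acyclic reorientation.
\<close>

lemma num_acyclic_rank1:
  assumes "a \<le> n"
  shows "num_balanced A n i 2 a 0 \<le> 2"
  using assms
proof (induction "n - a" arbitrary: a i)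
  case 0
  then show ?case using num_balanced_le_power[of i 2 a 0] by simp
next
  case (Suc k)
  have "num_balanced A n (Suc i) 1 (Suc a) (-1) = 0"
  proof -
    have "is_circuit A n (Suc i) 1 (Suc a) [(Suc a, 1)]" using Suc by (auto simp: is_circuit_def)
    then have "\<not> balanced A n (Suc i) 1 (Suc a) (-1) R" for R
      unfolding balanced_def by fastforce
    then show ?thesis by (simp add: num_balanced_def)
  qed
  moreover have "Suc a \<le> n" "k = n - Suc a" using Suc.hyps(2) by simp_all
  ultimately show ?case
    using num_balanced_deletion_contraction[of a 2 i 0] Suc.hyps(1)[of "Suc a" i] Suc.hyps(2) by simp
qed

theorem num_acyclic:
  assumes "a \<le> n"
  shows "num_balanced A n i (d + 2) a (int d) \<le> 2 * binomial_sum (n - a) d"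
  using assms
proof (induction d arbitrary: a i)
  case 0
  then show ?case using num_acyclic_rank1[of a i] by (simp add: numeral_2_eq_2)
next
  case (Suc d)
  from Suc.prems show ?case
  proof (induction "n - a" arbitrary: a i)
    case 0
    then show ?case using num_balanced_le_power[of i "Suc d + 2" a "int (Suc d)"]
      by simp
  next
    case (Suc k)
    have "n - a = Suc (n - Suc a)" "Suc a \<le> n" using Suc.hyps(2) by simp_all
    then show ?case
      using num_balanced_deletion_contraction[of a "Suc d + 2" i "int (Suc d)"]
        Suc.hyps(1)[of "Suc a" i] Suc.IH(1)[of "Suc a" "Suc i"] Suc.hyps(2)
      by (simp add: binomial_sum_Suc)
  qed
qed

lemma circuit_on_columns:
  assumes "sorted_wrt (<) xs" "xs \<noteq> []"
  shows "\<exists>L. chain A i L \<and> map fst L = xs \<and> snd ` set L \<subseteq> {1,-1}"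
  using assms
proof (induction xs arbitrary: i)
  case (Cons x xs)
  show ?case
  proof (cases xs)
    case Nil
    then show ?thesis by (intro exI[of _ "[(x,1)]"]) auto
  next
    case (Cons y ys)
    then obtain L where L: "chain A (Suc i) L" "map fst L = xs" "snd ` set L \<subseteq> {1,-1}"
      using Cons.IH[of "Suc i"] Cons.prems by auto
    then obtain u K where K: "L = (y,u) # K" using Cons by (cases L) auto
    show ?thesis
      using L K Cons.prems Cons sign[of i x] sign[of i y]
      by (intro exI[of _ "(x, - (u * A i y * A i x)) # L"]) auto
  qed
qed auto

text \<open>
  Flipping one sign changes a sum by \<open>\<plusminus>2\<close>, which is \<open>2\<close> modulo \<open>4\<close>.
\<close>

lemma bal_diff_mod4:
  assumes "snd ` set L \<subseteq> {1,-1}"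
  shows "\<exists>q. bal R L - bal R' L = 2 * int (length (filter (\<lambda>x. (x \<in> R) \<noteq> (x \<in> R')) (map fst L))) + 4 * q"
  using assms
proof (induction L)
  case (Cons b L)
  obtain x s where b: "b = (x,s)" by (cases b)
  obtain q where q: "bal R L - bal R' L =
     2 * int (length (filter (\<lambda>x. (x \<in> R) \<noteq> (x \<in> R')) (map fst L))) + 4 * q"
    using Cons by auto
  have s: "s = 1 \<or> s = -1" using Cons.prems b by auto
  have "\<exists>q'. s * sgn_at R x - s * sgn_at R' x = 2 * of_bool ((x \<in> R) \<noteq> (x \<in> R')) + 4 * q'"
  proof (cases "(x \<in> R) = (x \<in> R')")
    case True
    then show ?thesis by (intro exI[of _ 0]) (simp add: sgn_at_def)
  next
    case False
    then have "s * sgn_at R x - s * sgn_at R' x = 2 * 1 + 4 * (if s * sgn_at R x = 1 then 0 else -1)"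
      using s by (auto simp: sgn_at_def)
    then show ?thesis using False by auto
  qed
  then obtain q' where "s * sgn_at R x - s * sgn_at R' x = 2 * of_bool ((x \<in> R) \<noteq> (x \<in> R')) + 4 * q'" ..
  then show ?case using q by (intro exI[of _ "q + q'"]) (auto simp: b)
qed auto

lemma even_disagreement:
  assumes R: "balanced A n i m a 0 R" and R': "balanced A n i m a 0 R'"
    and S: "S \<subseteq> {a..n}" "card S = m" "0 < m"
  shows "even (card {x\<in>S. (x \<in> R) \<noteq> (x \<in> R')})"
proof -
  have fin: "finite S" using S(1) finite_subset by blast
  define xs where "xs = sorted_list_of_set S"
  have xs: "sorted_wrt (<) xs" "set xs = S" "length xs = m" "distinct xs"
    using fin S by (auto simp: xs_def)
  obtain L where L: "chain A i L" "map fst L = xs" "snd ` set L \<subseteq> {1,-1}"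
    using circuit_on_columns[OF xs(1)] xs(3) S(3) by fastforce
  have "fst ` set L = S" using L(2) xs(2) by (metis set_map)
  then have "set L \<subseteq> {a..n} \<times> {1,-1}" using L(3) S(1) by fastforce
  moreover have "length L = m" using L(2) xs(3) by (metis length_map)
  ultimately have "is_circuit A n i m a L" using L(1) by (simp add: is_circuit_def)
  then have "bal R L = 0" "bal R' L = 0" using R R' by (auto simp: balanced_def)
  moreover obtain q where "bal R L - bal R' L =
     2 * int (length (filter (\<lambda>x. (x \<in> R) \<noteq> (x \<in> R')) xs)) + 4 * q"
    using bal_diff_mod4[OF L(3)] L(2) by metis
  ultimately have "int (length (filter (\<lambda>x. (x \<in> R) \<noteq> (x \<in> R')) xs)) = 2 * (- q)" by simp
  then have "even (length (filter (\<lambda>x. (x \<in> R) \<noteq> (x \<in> R')) xs))" by presburger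
  moreover have "length (filter (\<lambda>x. (x \<in> R) \<noteq> (x \<in> R')) xs) = card {x\<in>S. (x \<in> R) \<noteq> (x \<in> R')}"
    using distinct_card[of "filter (\<lambda>x. (x \<in> R) \<noteq> (x \<in> R')) xs"] xs(2,4) by simp
  ultimately show ?thesis by simp
qed

text \<open>
  If \<open>R\<close> and \<open>R'\<close> make all circuit sums zero, they disagree on an even number of elements of every
  \<open>m\<close>-subset. Exchanging an element of disagreement for one of agreement changes that parity, so one of
  the two kinds does not occur: \<open>R'\<close> is \<open>R\<close> or its complement.
\<close>

theorem num_rigid:
  assumes "0 < m" "a + m \<le> n"
  shows "num_balanced A n i m a 0 \<le> 2"
proof -
  let ?G = "{R. R \<subseteq> {a..n} \<and> balanced A n i m a 0 R}"
  have two: "R' = R \<or> R' = {a..n} - R" if RR: "R \<in> ?G" "R' \<in> ?G" for R R'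
  proof (rule ccontr)
    assume neg: "\<not> (R' = R \<or> R' = {a..n} - R)"
    let ?D = "\<lambda>x. (x \<in> R) \<noteq> (x \<in> R')"
    obtain u where u: "u \<in> {a..n}" "?D u" using neg RR by blast
    obtain v where v: "v \<in> {a..n}" "\<not> ?D v" using neg RR by blast
    have "u \<noteq> v" using u v by auto
    then have "card ({a..n} - {u,v}) = Suc n - a - 2"
      using u v by (simp add: card_Diff_subset)
    then have "m - 1 \<le> card ({a..n} - {u,v})" using assms by simp
    then obtain S where S: "S \<subseteq> {a..n} - {u,v}" "card S = m - 1"
      by (rule obtain_subset_with_card_n)
    have fin: "finite S" using S(1) finite_subset by blast
    have nin: "u \<notin> S" "v \<notin> S" using S by auto
    have "even (card {x \<in> insert w S. ?D x})" if "w \<in> {u,v}" for w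
    proof (rule even_disagreement[where m = m])
      show "card (insert w S) = m" using that nin fin S(2) assms(1) by auto
    qed (use RR assms u v S that in auto)
    then have "even (card {x \<in> insert u S. ?D x})" "even (card {x \<in> insert v S. ?D x})" by auto
    moreover have "{x \<in> insert u S. ?D x} = insert u {x\<in>S. ?D x}" "{x \<in> insert v S. ?D x} = {x\<in>S. ?D x}"
      using u v by auto
    ultimately show False using nin fin by simp
  qed
  show ?thesis
  proof (cases "?G = {}")
    case False
    then obtain R where R: "R \<in> ?G" by auto
    then have "?G \<subseteq> {R, {a..n} - R}" using two[OF R] by blast
    then have "card ?G \<le> card {R, {a..n} - R}" by (intro card_mono) auto
    also have "\<dots> \<le> 2" by (simp add: card_insert_if)
    finally show ?thesis by (simp add: num_balanced_def)
  next
    case True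
    then show ?thesis unfolding num_balanced_def by (simp only: card.empty)
  qed
qed

text \<open>
  Circuits have \<open>2k + d + 2\<close> elements, that is, the rank is \<open>2k + 1 + d\<close>. The required number of columns,
  \<open>2k + 3 + 2d\<close>, is what all three terms of the recursion inherit.
\<close>

theorem num_balanced_upper:
  assumes "a + 2 * k + 2 * d + 2 \<le> n"
  shows "num_balanced A n i (2 * k + d + 2) a (int d) \<le> 2 * binomial_sum (n - a) d"
  using assms
proof (induction k arbitrary: a d i)
  case 0
  then show ?case using num_acyclic[of a i d] by simp
next
  case (Suc k)
  note outer = Suc.IH
  from Suc.prems show ?case
  proof (induction d arbitrary: a i)
    case 0
    then show ?case using num_rigid[of "2 * Suc k + 2" a i] by simp
  next
    case (Suc d)
    have "num_balanced A n i (2 * Suc k + Suc d + 2) a (int (Suc d)) \<le>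
      num_balanced A n (Suc (Suc i)) (2 * k + Suc d + 2) (Suc (Suc a)) (int (Suc d)) +
      num_balanced A n (Suc i) (2 * Suc k + d + 2) (Suc a) (int d) +
      num_balanced A n (Suc i) (2 * Suc k + d + 2) (Suc (Suc a)) (int d)"
      using num_balanced_inseparable_pair[of a "2 * Suc k + Suc d + 2" i "int (Suc d)"] Suc.prems
      by simp
    also have "\<dots> \<le> 2 * binomial_sum (n - Suc (Suc a)) (Suc d) + 2 * binomial_sum (n - Suc a) d +
      2 * binomial_sum (n - Suc (Suc a)) d"
      using Suc.prems by (intro add_mono outer Suc.IH) auto
    also have "\<dots> = 2 * binomial_sum (n - a) (Suc d)"
    proof -
      obtain N where "n - a = Suc (Suc N)" "n - Suc a = Suc N" "n - Suc (Suc a) = N"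
        using Suc.prems by (intro that[of "n - Suc (Suc a)"]) auto
      then show ?thesis by (simp add: binomial_sum_Suc)
    qed
    finally show ?case .
  qed
qed

section \<open>Two and three elements more than the rank\<close>

text \<open>
  A circuit omits exactly one column \<open>a + t\<close>. Before the gap its signs follow \<open>al\<close>, the signs of the chain that
  starts at column \<open>a\<close> without a gap; after the gap every column is one position earlier in the circuit, which
  shifts the rows by one, and the signs follow \<open>be\<close> up to a factor. Matching both at the gap gives the factor \<open>- al t * be t\<close>. In
  terms of the signs \<open>y\<close> of the columns relative to \<open>al\<close>, the circuit sums are window sums with
  coefficients \<open>q = al * be\<close>.
\<close>

theorem num_corank2:
  assumes "a + 2 * j + 1 = n"
  shows "num_balanced A n i (2 * j + 1) a 1 \<le> 2 ^ (j + 2)"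
proof -
  let ?N = "2 * j + 2"
  define al where "al = rec_nat 1 (\<lambda>p r. - r * A (i+p) (a+p) * A (i+p) (a+p+1))"
  \<comment> \<open>The step from \<open>0\<close> to \<open>1\<close> uses the row \<open>i - 1\<close>, truncated at zero. Its value only fixes the sign of
    the later values relative to \<open>be 0\<close>, which is visible in the circuit without column \<open>a\<close> alone and
    there amounts to negating the whole circuit.\<close>
  define be where "be = rec_nat 1 (\<lambda>p r. - r * A (i+p-1) (a+p) * A (i+p-1) (a+p+1))"
  have al: "al (Suc p) = - al p * A (i+p) (a+p) * A (i+p) (a+p+1)" for p by (simp add: al_def)
  have be: "be (Suc p) = - be p * A (i+p-1) (a+p) * A (i+p-1) (a+p+1)" for p by (simp add: be_def)
  have al1: "al p = 1 \<or> al p = -1" for p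
  proof (induction p)
    case (Suc p)
    then show ?case using sign[of "i+p" "a+p"] sign[of "i+p" "a+p+1"] by (auto simp: al)
  qed (simp add: al_def)
  have be1: "be p = 1 \<or> be p = -1" for p
  proof (induction p)
    case (Suc p)
    then show ?case using sign[of "i+p-1" "a+p"] sign[of "i+p-1" "a+p+1"] by (auto simp: be)
  qed (simp add: be_def)
  have AA: "A x y * A x y = 1" "A x y * (A x y * z) = z" for x y z using sign[of x y] by auto
  define q where "q p = al p * be p" for p
  define y where "y R p = al p * sgn_at R (a+p)" for R p
  define C where "C t = map (\<lambda>k. if k < t then (a+k, al k) else (Suc (a+k), - q t * be (Suc k))) [0..<2*j+1]" for t
  have circ: "is_circuit A n i (2 * j + 1) a (C t)" if t: "t < ?N" for t
    unfolding is_circuit_def chain_nth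
  proof (intro conjI allI impI)
    show "length (C t) = 2 * j + 1" by (simp add: C_def del: upt_Suc)
    show "set (C t) \<subseteq> {a..n} \<times> {1,-1}"
    proof
      fix z assume "z \<in> set (C t)"
      then obtain k where k: "k < 2*j+1" "z = (if k < t then (a+k, al k) else (Suc (a+k), - q t * be (Suc k)))"
        by (auto simp: C_def simp del: upt_Suc)
      then show "z \<in> {a..n} \<times> {1,-1}"
        using assms al1[of k] al1[of t] be1[of t] be1[of "Suc k"] by (auto simp: q_def)
    qed
    fix k assume k: "Suc k < length (C t)"
    have nth: "C t ! l = (if l < t then (a+l, al l) else (Suc (a+l), - q t * be (Suc l)))" if "l < 2*j+1" for l
      using that by (simp add: C_def del: upt_Suc)
    have k': "Suc k < 2*j+1" using k by (simp add: C_def del: upt_Suc)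
    show "fst (C t ! k) < fst (C t ! Suc k)" using k' by (simp add: nth)
    consider "Suc k < t" | "t = Suc k" | "t \<le> k" by linarith
    then show "snd (C t ! Suc k) * A (i + k) (fst (C t ! Suc k)) = - (snd (C t ! k) * A (i + k) (fst (C t ! k)))"
    proof cases
      case 1
      then show ?thesis using k' by (simp add: nth al AA mult.assoc)
    next
      case 2
      have "be (Suc (Suc k)) = - be (Suc k) * A (i+k) (Suc (a+k)) * A (i+k) (Suc (Suc (a+k)))"
        using be[of "Suc k"] by simp
      moreover have "al (Suc k) = - al k * A (i+k) (a+k) * A (i+k) (Suc (a+k))"
        using al[of k] by simp
      moreover have "C t ! Suc k = (Suc (Suc (a+k)), - q (Suc k) * be (Suc (Suc k)))" "C t ! k = (a+k, al k)"
        using nth[OF k'] nth[of k] k' 2 by simp_all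
      ultimately show ?thesis
        using be1[of "Suc k"] sign[of "i+k" "Suc (a+k)"] sign[of "i+k" "Suc (Suc (a+k))"]
        by (auto simp: q_def)
    next
      case 3
      then show ?thesis using k' by (simp add: nth be AA mult.assoc)
    qed
  qed
  have bal_C: "bal R (C t) = (\<Sum>p\<in>{0..<t}. y R p) - q t * (\<Sum>p\<in>{Suc t..<?N}. q p * y R p)" if t: "t < ?N" for R t
  proof -
    let ?f = "\<lambda>k. if k < t then y R k else - q t * (q (Suc k) * y R (Suc k))"
    have qy: "q p * y R p = be p * sgn_at R (a+p)" for p using al1[of p] by (auto simp: q_def y_def)
    have "bal R (C t) = (\<Sum>k\<leftarrow>[0..<2*j+1]. ?f k)"
      unfolding bal_def C_def map_map
      by (intro arg_cong[where f = sum_list] map_cong refl) (simp add: qy, simp add: y_def)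
    also have "\<dots> = (\<Sum>k\<in>{0..<2*j+1}. ?f k)" by (simp only: interv_sum_list_conv_sum_set_nat set_upt)
    also have "\<dots> = (\<Sum>k\<in>{0..<t}. ?f k) + (\<Sum>k\<in>{t..<2*j+1}. ?f k)"
      using t by (intro sum.atLeastLessThan_concat[symmetric]) auto
    also have "(\<Sum>k\<in>{0..<t}. ?f k) = (\<Sum>p\<in>{0..<t}. y R p)" by simp
    also have "(\<Sum>k\<in>{t..<2*j+1}. ?f k) = (\<Sum>k\<in>{t..<2*j+1}. - q t * (q (Suc k) * y R (Suc k)))"
      by (intro sum.cong) auto
    also have "\<dots> = - q t * (\<Sum>p\<in>{Suc t..<?N}. q p * y R p)"
      unfolding sum_distrib_left[symmetric] using sum.shift_bounds_Suc_ivl[of "\<lambda>p. q p * y R p" t "2*j+1"] by simp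
    finally show ?thesis by simp
  qed
  let ?G = "{R. R \<subseteq> {a..n} \<and> balanced A n i (2 * j + 1) a 1 R}"
  let ?Y = "\<lambda>R. map (y R) [0..<?N]"
  have sub: "?Y ` ?G \<subseteq> {ys \<in> sign_lists ?N. windows_balanced 0 (map q [0..<?N]) ys}"
  proof (intro image_subsetI CollectI conjI)
    fix R assume R: "R \<in> ?G"
    show "windows_balanced 0 (map q [0..<?N]) (?Y R)"
    proof (rule windows_balanced_map_upt)
      fix t assume "t < ?N"
      then show "\<bar>0 + (\<Sum>p\<in>{0..<t}. y R p) - q t * (\<Sum>p\<in>{Suc t..<?N}. q p * y R p)\<bar> \<le> 1"
        using R circ[of t] bal_C[of t R] by (auto simp: balanced_def)
    qed
    have "y R p = 1 \<or> y R p = -1" for p using al1[of p] sgn_at_cases[of R "a+p"] by (auto simp: y_def)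
    then show "?Y R \<in> sign_lists ?N" by (auto simp: sign_lists_def)
  qed
  have inj: "inj_on ?Y ?G"
  proof (rule inj_onI)
    fix R R' assume R: "R \<in> ?G" "R' \<in> ?G" and eq: "?Y R = ?Y R'"
    have "x \<in> R \<longleftrightarrow> x \<in> R'" if x: "x \<in> {a..n}" for x
    proof -
      have "x - a < ?N" using x assms by auto
      then have "y R (x - a) = y R' (x - a)" using eq by (metis atLeastLessThan_iff map_eq_conv set_upt zero_le)
      then have "sgn_at R x = sgn_at R' x" using x al1[of "x - a"] by (auto simp: y_def)
      then show ?thesis by (auto simp: sgn_at_def split: if_splits)
    qed
    then show "R = R'" using R by blast
  qed
  have "card ?G \<le> card {ys \<in> sign_lists ?N. windows_balanced 0 (map q [0..<?N]) ys}"
    by (rule card_inj_on_le[OF inj sub]) simp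
  also have "\<dots> \<le> 2 ^ (j + 2)"
  proof (rule card_windows_balanced)
    have "q p = 1 \<or> q p = -1" for p using al1[of p] be1[of p] by (auto simp: q_def)
    then show "set (map q [0..<?N]) \<subseteq> {1,-1}" by auto
  qed simp
  finally show ?thesis by (simp add: num_balanced_def)
qed

text \<open>
  The recursion ends at rank three with six columns, where at most \<open>2^5\<close> sets are admissible. The step
  from \<open>k\<close> to \<open>k + 1\<close> adds \<open>2(2k + 7)\<close> from the binomial bound and \<open>2^(k+4)\<close> from
  \<open>num_corank2\<close>, and the right-hand side is the closed form of these sums.
\<close>

theorem num_corank3:
  assumes "a + 2 * k + 5 = n"
  shows "num_balanced A n i (2 * k + 4) a 2 \<le> 2 ^ (k + 4) + 2 * k ^ 2 + 12 * k + 16"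
  using assms
proof (induction k arbitrary: a i)
  case 0
  then have "n - a = 5" by simp
  then show ?case using num_acyclic[of a i 2] 0 by (simp add: binomial_sum_def eval_nat_numeral)
next
  case (Suc k)
  have "num_balanced A n i (2 * Suc k + 4) a 2 \<le>
      num_balanced A n (Suc (Suc i)) (2 * k + 4) (Suc (Suc a)) 2 +
      num_balanced A n (Suc i) (2 * Suc k + 1 + 2) (Suc a) (int 1) +
      num_balanced A n (Suc i) (2 * (k + 2) + 1) (Suc (Suc a)) 1"
    using num_balanced_inseparable_pair[of a "2 * Suc k + 4" i 2] Suc.prems
    by (simp add: eval_nat_numeral)
  also have "\<dots> \<le> (2 ^ (k + 4) + 2 * k ^ 2 + 12 * k + 16) + 2 * binomial_sum (n - Suc a) 1 + 2 ^ (k + 2 + 2)"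
    using Suc.prems by (intro add_mono Suc.IH num_balanced_upper num_corank2) auto
  also have "binomial_sum (n - Suc a) 1 = 2 * k + 7"
    using Suc.prems by (simp add: binomial_sum_def)
  also have "2 ^ (k + 4) + 2 * k ^ 2 + 12 * k + 16 + 2 * (2 * k + 7) + 2 ^ (k + 2 + 2) =
      2 ^ (Suc k + 4) + 2 * (Suc k) ^ 2 + 12 * Suc k + 16"
    by (simp add: power2_eq_square algebra_simps power_add)
  finally show ?case .
qed

end

section \<open>Neighborliness as a bound on sign sums\<close>

lemma bal_eq_diff:
  assumes "snd ` set L \<subseteq> {1,-1}"
  shows "bal R L = int (length (filter (\<lambda>(x,s). s * sgn_at R x = 1) L)) -
           int (length (filter (\<lambda>(x,s). s * sgn_at R x = -1) L))" (is ?diff)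
    and "length (filter (\<lambda>(x,s). s * sgn_at R x = 1) L) +
         length (filter (\<lambda>(x,s). s * sgn_at R x = -1) L) = length L" (is ?total)
proof -
  have "?diff \<and> ?total" using assms
  proof (induction L)
    case (Cons b L)
    obtain x s where b: "b = (x,s)" by (cases b)
    then have "s * sgn_at R x = 1 \<or> s * sgn_at R x = -1"
      using Cons.prems sgn_at_cases[of R x] by auto
    then show ?case using Cons b by auto
  qed simp
  then show ?diff ?total by simp_all
qed

text \<open>
  A sign sum is the number of positive minus the number of negative elements, while both numbers add up
  to \<open>r + 1\<close>. So the smaller one exceeds \<open>k\<close> iff the absolute value of the sum is at most \<open>r + 1 - 2(k + 1)\<close>.
\<close>

lemma neighborly_iff_balanced:
  assumes "sign_matrix r n A"
  shows "neighborly k (reorient R (lawrence r n A)) \<longleftrightarrow>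
    balanced A n 1 (r + 1) 1 (int r - 1 - 2 * int k) R"
proof -
  define flip where "flip X = (\<lambda>e. if e \<in> R then - X e else X e)" for X :: "nat \<Rightarrow> int"
  have key: "card (pos_part (flip X)) > k \<and> card (neg_part (flip X)) > k \<longleftrightarrow>
      \<bar>bal R L\<bar> \<le> int r - 1 - 2 * int k"
    if L: "chain A 1 L" "length L = r + 1" "set L \<subseteq> {1..n} \<times> {1,-1}"
      and X: "\<And>e s. (e,s) \<in> set L \<longleftrightarrow> X e = s \<and> s \<noteq> 0" for X L
  proof -
    have d: "distinct (map fst L)"
      using chain_sorted[OF L(1)] by (simp add: strict_sorted_iff)
    have flip: "flip X e = X e * sgn_at R e" for e by (simp add: flip_def sgn_at_def)
    have part: "card {e. flip X e = c} = length (filter (\<lambda>(x,s). s * sgn_at R x = c) L)"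
      if "c \<noteq> 0" for c
    proof -
      let ?F = "filter (\<lambda>(x,s). s * sgn_at R x = c) L"
      have "{e. flip X e = c} = set (map fst ?F)"
      proof (intro set_eqI iffI)
        fix e assume "e \<in> {e. flip X e = c}"
        then have "(e, X e) \<in> set ?F" using X[of e "X e"] that by (auto simp: flip)
        then show "e \<in> set (map fst ?F)" by force
      next
        fix e assume "e \<in> set (map fst ?F)"
        then obtain s where "(e,s) \<in> set L" "s * sgn_at R e = c" by auto
        then show "e \<in> {e. flip X e = c}" using X[of e s] by (simp add: flip)
      qed
      then show ?thesis
        using distinct_card[OF distinct_map_filter[OF d], of "\<lambda>(x,s). s * sgn_at R x = c"] by simp
    qed
    have "snd ` set L \<subseteq> {1,-1}" using L(3) by auto
    from bal_eq_diff[OF this, of R] show ?thesis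
      using part[of 1] part[of "-1"] L(2) unfolding pos_part_def neg_part_def by auto
  qed
  have "neighborly k (reorient R (lawrence r n A)) \<longleftrightarrow>
     (\<forall>X\<in>circuits (lawrence r n A). card (pos_part (flip X)) > k \<and> card (neg_part (flip X)) > k)"
    by (auto simp: neighborly_def reorient_def flip_def)
  also have "\<dots> \<longleftrightarrow> balanced A n 1 (r + 1) 1 (int r - 1 - 2 * int k) R"
  proof
    assume *: "\<forall>X\<in>circuits (lawrence r n A). card (pos_part (flip X)) > k \<and> card (neg_part (flip X)) > k"
    show "balanced A n 1 (r + 1) 1 (int r - 1 - 2 * int k) R"
      unfolding balanced_def
    proof (intro allI impI)
      fix L assume "is_circuit A n 1 (r+1) 1 L"
      then have L: "chain A 1 L" "length L = r + 1" "set L \<subseteq> {1..n} \<times> {1,-1}"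
        by (simp_all add: is_circuit_def)
      obtain X where "X \<in> circuits (lawrence r n A)" "\<And>e s. (e,s) \<in> set L \<longleftrightarrow> X e = s \<and> s \<noteq> 0"
        using circuit_of_chain[OF assms L] by blast
      then show "\<bar>bal R L\<bar> \<le> int r - 1 - 2 * int k" using key[OF L] * by blast
    qed
  next
    assume *: "balanced A n 1 (r + 1) 1 (int r - 1 - 2 * int k) R"
    show "\<forall>X\<in>circuits (lawrence r n A). card (pos_part (flip X)) > k \<and> card (neg_part (flip X)) > k"
    proof
      fix X assume "X \<in> circuits (lawrence r n A)"
      then obtain L where L: "chain A 1 L" "length L = r + 1" "set L \<subseteq> {1..n} \<times> {1,-1}"
        "\<And>e s. (e,s) \<in> set L \<longleftrightarrow> X e = s \<and> s \<noteq> 0"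
        by (rule circuitE[OF assms]) blast
      then have "\<bar>bal R L\<bar> \<le> int r - 1 - 2 * int k" using * by (simp add: balanced_def is_circuit_def)
      then show "card (pos_part (flip X)) > k \<and> card (neg_part (flip X)) > k" using key[OF L] by simp
    qed
  qed
  finally show ?thesis .
qed

lemma num_neighborly_lawrence:
  assumes "sign_matrix r n A"
  shows "num_neighborly (lawrence r n A) k = num_balanced A n 1 (r + 1) 1 (int r - 1 - 2 * int k)"
  unfolding num_neighborly_def num_balanced_def neighborly_iff_balanced[OF assms]
  by (simp add: lawrence_def)

section \<open>The alternating oriented matroid\<close>

abbreviation ones :: "nat \<Rightarrow> nat \<Rightarrow> int" where "ones \<equiv> (\<lambda>_ _. 1)"

text \<open>
  Membership changes between \<open>j\<close> and \<open>j + 1\<close> exactly for \<open>j \<in> D\<close>, starting with \<open>1\<close> outside. This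
  parametrises the subsets of \<open>{1..n}\<close>, up to complement, by the subsets of \<open>{1..<n}\<close>.
\<close>

definition with_changes :: "nat \<Rightarrow> nat set \<Rightarrow> nat set" where
  "with_changes n D = {x \<in> {1..n}. odd (card {j\<in>D. j < x})}"

lemma with_changes_Suc:
  assumes "finite D" "1 \<le> x" "x < n"
  shows "(Suc x \<in> with_changes n D) \<noteq> (x \<in> with_changes n D) \<longleftrightarrow> x \<in> D"
proof -
  have "{j\<in>D. j < Suc x} = (if x \<in> D then insert x {j\<in>D. j < x} else {j\<in>D. j < x})" by (auto simp: less_Suc_eq)
  then show ?thesis using assms by (auto simp: with_changes_def)
qed

lemma one_notin_with_changes:
  assumes "D \<subseteq> {1..<n}"
  shows "1 \<notin> with_changes n D"
proof -
  have "{j\<in>D. j < 1} = {}" using assms by auto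
  then have "even (card {j\<in>D. j < 1})" by (simp only: card.empty even_zero)
  then show ?thesis unfolding with_changes_def by blast
qed

lemma inj_on_with_changes:
  assumes "\<And>D. D \<in> \<D> \<Longrightarrow> D \<subseteq> {1..<n}"
  shows "inj_on (with_changes n) \<D>"
proof (rule inj_onI)
  fix D E assume DE: "D \<in> \<D>" "E \<in> \<D>" and eq: "with_changes n D = with_changes n E"
  have "finite D" "finite E" using DE assms finite_subset[OF _ finite_atLeastLessThan] by blast+
  then have "x \<in> D \<longleftrightarrow> x \<in> E" if "x \<in> {1..<n}" for x
    using with_changes_Suc[of D x n] with_changes_Suc[of E x n] eq that by simp
  then show "D = E" using DE assms by blast
qed

text \<open>
  Complementing \<open>R\<close> negates every sign sum, and it never leads from one set without \<open>1\<close> to another one.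
\<close>

lemma num_balanced_ge_changes:
  assumes "1 \<le> n" "\<And>D. D \<in> \<D> \<Longrightarrow> D \<subseteq> {1..<n} \<and> balanced A n i m 1 d (with_changes n D)"
  shows "2 * card \<D> \<le> num_balanced A n i m 1 d"
proof -
  let ?G = "{R. R \<subseteq> {1..n} \<and> balanced A n i m 1 d R}"
  let ?c = "\<lambda>D. {1..n} - with_changes n D"
  have sub: "with_changes n D \<subseteq> {1..n}" for D by (auto simp: with_changes_def)
  have fin: "finite \<D>"
    by (rule finite_subset[of _ "Pow {1..<n}"]) (use assms(2) in auto)
  have inj: "inj_on (with_changes n) \<D>" using inj_on_with_changes assms(2) by blast
  have injc: "inj_on ?c \<D>"
    using inj sub by (intro inj_onI) (metis double_diff inj_on_def subset_refl)
  have "balanced A n i m 1 d ({1..n} - R)" if "balanced A n i m 1 d R" for R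
    unfolding balanced_def
  proof (intro allI impI)
    fix L assume L: "is_circuit A n i m 1 L"
    then have "fst ` set L \<subseteq> {1..n}" by (auto simp: is_circuit_def)
    then have "bal ({1..n} - R) L = - bal R L"
      by (induction L) (auto simp: sgn_at_def)
    then show "\<bar>bal ({1..n} - R) L\<bar> \<le> d" using that L by (simp add: balanced_def)
  qed
  then have "with_changes n ` \<D> \<union> ?c ` \<D> \<subseteq> ?G" using assms(2) sub by (intro Un_least image_subsetI CollectI conjI) auto
  then have "card (with_changes n ` \<D> \<union> ?c ` \<D>) \<le> card ?G" by (intro card_mono) auto
  moreover have "1 \<notin> with_changes n D" "1 \<in> ?c D" if "D \<in> \<D>" for D
    using one_notin_with_changes[of D n] assms(1) assms(2)[OF that] by auto
  then have "with_changes n ` \<D> \<inter> ?c ` \<D> = {}" by blast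
  then have "card (with_changes n ` \<D> \<union> ?c ` \<D>) = 2 * card \<D>"
    using card_Un_disjoint[of "with_changes n ` \<D>" "?c ` \<D>"] fin
    unfolding card_image[OF inj] card_image[OF injc] by simp
  ultimately show ?thesis by (simp add: num_balanced_def)
qed

lemma bal_parity:
  assumes "snd ` set L \<subseteq> {1,-1}"
  shows "even (bal R L) \<longleftrightarrow> even (length L)"
  using assms
proof (induction L)
  case (Cons b L)
  obtain x s where b: "b = (x,s)" by (cases b)
  then have "odd (s * sgn_at R x)" using Cons.prems sgn_at_cases[of R x] by auto
  then show ?case using Cons b by auto
qed simp

text \<open>
  The signs of a circuit alternate, so neighbouring elements cancel unless \<open>D\<close> has an element between them.
  The sum is multiplied by the reoriented sign of the first element; \<open>c\<close> counts the changes still to come.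
  The bounds are asymmetric because a circuit without changes sums to \<open>0\<close> or \<open>1\<close>.
\<close>

lemma bal_changes_bounds:
  assumes "finite D" "chain ones i ((x,s) # L)" "set ((x,s) # L) \<subseteq> {1..n} \<times> {1,-1}"
  defines "v \<equiv> s * sgn_at (with_changes n D) x * bal (with_changes n D) ((x,s) # L)"
    and "c \<equiv> int (card D) - int (card {j\<in>D. j < x})"
  shows "- c \<le> v \<and> v \<le> c + 1"
  using assms(2,3) unfolding v_def c_def
proof (induction L arbitrary: i x s)
  case Nil
  have "card {j\<in>D. j < x} \<le> card D" using assms(1) by (intro card_mono) auto
  then show ?case using Nil sgn_at_cases[of "with_changes n D" x] by auto
next
  case (Cons b L)
  obtain y t where b: "b = (y,t)" by (cases b)
  let ?R = "with_changes n D"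
  let ?v = "t * sgn_at ?R y * bal ?R ((y,t) # L)"
  have t: "t = - s" and xy: "x < y" and ch: "chain ones (Suc i) ((y,t) # L)"
    using Cons.prems(1) by (auto simp: b)
  have s: "s = 1 \<or> s = -1" and mem: "x \<in> {1..n}" "y \<in> {1..n}" using Cons.prems(2) by (auto simp: b)
  have IH: "- (int (card D) - int (card {j\<in>D. j < y})) \<le> ?v"
    "?v \<le> int (card D) - int (card {j\<in>D. j < y}) + 1"
    using Cons.IH[OF ch] Cons.prems(2) by (auto simp: b)
  have mono: "card {j\<in>D. j < x} \<le> card {j\<in>D. j < y}"
    using assms(1) xy by (intro card_mono) auto
  have v: "s * sgn_at ?R x * bal ?R ((x,s) # b # L) = 1 - sgn_at ?R x * sgn_at ?R y * ?v"
    using s t sgn_at_cases[of ?R x] sgn_at_cases[of ?R y] by (auto simp: b)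
  show ?case
  proof (cases "(x \<in> ?R) = (y \<in> ?R)")
    case True
    then have "sgn_at ?R x * sgn_at ?R y = 1" by (simp add: sgn_at_def)
    then show ?thesis unfolding v using IH mono by simp
  next
    case False
    then have "sgn_at ?R x * sgn_at ?R y = -1" by (auto simp: sgn_at_def)
    moreover have "card {j\<in>D. j < x} \<noteq> card {j\<in>D. j < y}" using False mem by (auto simp: with_changes_def)
    ultimately show ?thesis unfolding v using IH mono by simp
  qed
qed

text \<open>
  The bound from \<open>bal_changes_bounds\<close> allows \<open>d + 1\<close>, which the parity of the circuit size rules out.
\<close>

theorem balanced_few_changes:
  assumes "finite D" "card D \<le> d" "even m \<longleftrightarrow> even d"
  shows "balanced ones n i m 1 (int d) (with_changes n D)"
  unfolding balanced_def
proof (intro allI impI)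
  fix L assume L: "is_circuit ones n i m 1 L"
  show "\<bar>bal (with_changes n D) L\<bar> \<le> int d"
  proof (cases L)
    case (Cons b K)
    obtain x s where b: "b = (x,s)" by (cases b)
    let ?B = "bal (with_changes n D) L"
    have "- int d \<le> s * sgn_at (with_changes n D) x * ?B" "s * sgn_at (with_changes n D) x * ?B \<le> int d + 1"
      using bal_changes_bounds[of D i x s K n] assms(1,2) L
      by (auto simp: is_circuit_def Cons b simp del: bal_Cons)
    moreover have "s = 1 \<or> s = -1" using L by (auto simp: is_circuit_def Cons b)
    moreover have "snd ` set L \<subseteq> {1,-1}" "length L = m" using L by (auto simp: is_circuit_def)
    then have "even ?B \<longleftrightarrow> even d"
      using bal_parity[of L "with_changes n D"] assms(3) by simp
    then have "?B \<noteq> int d + 1" "?B \<noteq> - (int d + 1)" by presburger+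
    ultimately show ?thesis using sgn_at_cases[of "with_changes n D" x] by auto
  qed simp
qed

text \<open>
  The sum over a circuit that leaves out \<open>w\<close> of the columns after \<open>c\<close> is compared with a prediction
  \<open>p c w\<close>. Taking the next column respects the prediction exactly, and each omitted column costs an error of
  at most \<open>1\<close>.
\<close>

lemma bal_near_path:
  fixes p :: "nat \<Rightarrow> nat \<Rightarrow> int"
  assumes "p n 0 = 0"
    and take: "\<And>c w. c < n \<Longrightarrow> p c w = sgn_at R (Suc c) - p (Suc c) w"
    and skip: "\<And>c w. c < n \<Longrightarrow> \<bar>p c (Suc w) - p (Suc c) w\<bar> \<le> 1"
  assumes "c \<le> n" "chain ones i L" "set L \<subseteq> {Suc c..n} \<times> {1,-1}" "length L + w = n - c"
    and "s = 1 \<or> s = -1" "L \<noteq> [] \<Longrightarrow> snd (hd L) = s"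
  shows "\<bar>s * bal R L - p c w\<bar> \<le> int w"
  using assms(4-)
proof (induction "n - c" arbitrary: c i L w s)
  case 0
  then show ?case using assms(1) by simp
next
  case (Suc k)
  then have c: "c < n" by simp
  show ?case
  proof (cases "\<exists>t L'. L = (Suc c, t) # L'")
    case True
    then obtain L' where L: "L = (Suc c, s) # L'" using Suc.prems by auto
    have ch: "chain ones (Suc i) L'" "L' \<noteq> [] \<Longrightarrow> snd (hd L') = - s"
      using Suc.prems(2) by (cases L'; auto simp: L)+
    have "fst ` set L' \<subseteq> {Suc (Suc c)..n}"
      using circuit_tail[of ones n i "length L" "Suc c" "Suc c" s L'] Suc.prems
      by (auto simp: L is_circuit_def)
    then have "\<bar>- s * bal R L' - p (Suc c) w\<bar> \<le> int w"
      using Suc.prems Suc.hyps(2) ch by (intro Suc.hyps(1)) (auto simp: L)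
    then show ?thesis using Suc.prems(5) take[OF c, of w] by (auto simp: L)
  next
    case False
    have sub: "set L \<subseteq> {Suc (Suc c)..n} \<times> {1,-1}"
    proof (cases L)
      case (Cons b L')
      obtain x t where b: "b = (x,t)" by (cases b)
      have "x \<noteq> Suc c" using False by (simp add: Cons b)
      then have "Suc c < x" using Suc.prems(3) by (simp add: Cons b)
      moreover have "fst ` set L' \<subseteq> {Suc x..n}"
        using circuit_tail[of ones n i "length L" "Suc c" x t L'] Suc.prems
        by (auto simp: Cons b is_circuit_def)
      ultimately show ?thesis using Suc.prems(3) by (fastforce simp: Cons b)
    qed simp
    have "length L = card (fst ` set L)"
      using distinct_card[of "map fst L"] chain_sorted[OF Suc.prems(2)] by (simp add: strict_sorted_iff)
    also have "\<dots> \<le> card {Suc (Suc c)..n}" using sub by (intro card_mono) auto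
    finally obtain w' where w: "w = Suc w'" using Suc.prems(4) c by (cases w) auto
    have "\<bar>s * bal R L - p (Suc c) w'\<bar> \<le> int w'"
      using Suc.prems Suc.hyps(2) sub w by (intro Suc.hyps(1)) auto
    then show ?thesis using skip[OF c, of w'] w by simp
  qed
qed

lemma balanced_near_path:
  fixes p :: "nat \<Rightarrow> nat \<Rightarrow> int"
  assumes "p n 0 = 0" "p 0 w = 0"
    and "\<And>c w. c < n \<Longrightarrow> p c w = sgn_at R (Suc c) - p (Suc c) w"
    and "\<And>c w. c < n \<Longrightarrow> \<bar>p c (Suc w) - p (Suc c) w\<bar> \<le> 1"
  shows "balanced ones n i (n - w) 1 (int w) R"
  unfolding balanced_def
proof (intro allI impI)
  fix L assume L: "is_circuit ones n i (n - w) 1 L"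
  show "\<bar>bal R L\<bar> \<le> int w"
  proof (cases L)
    case (Cons b K)
    have s: "snd (hd L) = 1 \<or> snd (hd L) = -1" using L by (auto simp: is_circuit_def Cons)
    have "\<bar>snd (hd L) * bal R L - p 0 w\<bar> \<le> int w"
      by (rule bal_near_path[OF assms(1,3,4), of 0 i L w "snd (hd L)"])
         (use L s in \<open>auto simp: is_circuit_def Cons\<close>)
    then show ?thesis using s assms(2) by auto
  qed simp
qed

text \<open>
  Both elements of a pair \<open>{1,2}, {3,4}, \<dots>\<close> lie on the same side of the set, so a pair taken completely cancels in an
  alternating sum. Only pairs that lose an element contribute. The prediction is zero at the end of a
  pair and the sign of the current pair in its middle.
\<close>

theorem balanced_pairs:
  assumes "even n" "D \<subseteq> {1..<n}" "\<And>x. x \<in> D \<Longrightarrow> even x"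
  shows "balanced ones n i (n - w) 1 (int w) (with_changes n D)"
proof -
  let ?r = "sgn_at (with_changes n D)"
  have fin: "finite D" using assms(2) finite_subset by blast
  have pair: "?r (Suc c) = ?r c" if "odd c" "c < n" for c
    using with_changes_Suc[OF fin, of c n] that assms(3)[of c] by (cases c) (auto simp: sgn_at_def)
  show ?thesis
    by (rule balanced_near_path[where p = "\<lambda>c w. if even c then 0 else ?r c"])
       (use assms(1) pair sgn_at_cases[of "with_changes n D"] in \<open>auto simp: sgn_at_def\<close>)
qed

text \<open>
  The same cancellation for the pairs \<open>{2,3}, \<dots>, {n-2,n-1}, {n,1}\<close>. The even number of changes puts \<open>n\<close> and
  \<open>1\<close> on the same side, and as the circuit has even size they cancel when they are its two ends. The
  prediction includes the contribution of the still distant partner \<open>n\<close>, whose sign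
  depends on the number of columns left out before it.
\<close>

theorem balanced_cyclic_pairs:
  assumes "even n" "0 < n" "even w" "D \<subseteq> {1..<n}" "\<And>x. x \<in> D \<Longrightarrow> odd x" "even (card D)"
  shows "balanced ones n i (n - w) 1 (int w) (with_changes n D)"
proof -
  let ?r = "sgn_at (with_changes n D)"
  let ?e = "\<lambda>c. if c = 0 then ?r n else ?r c"
  have fin: "finite D" using assms(4) finite_subset by blast
  have "{j\<in>D. j < n} = D" using assms(4) by auto
  then have "n \<notin> with_changes n D" using assms(6) by (simp add: with_changes_def)
  moreover have "Suc 0 \<notin> with_changes n D" using one_notin_with_changes[OF assms(4)] by simp
  ultimately have ends: "?r n = 1" "?r (Suc 0) = 1" by (auto simp: sgn_at_def)
  have pair: "?r (Suc c) = ?e c" if "even c" "c < n" for c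
    using with_changes_Suc[OF fin, of c n] that assms(5)[of c] ends by (cases c) (auto simp: sgn_at_def)
  show ?thesis
    by (rule balanced_near_path[where p = "\<lambda>c w. if even c then ?e c - (-1)^w * ?r n else (-1)^w * ?r n"])
       (use assms(1-3) pair ends sgn_at_cases[of "with_changes n D"] in \<open>auto simp: sgn_at_def\<close>)
qed

lemma card_subsets_with_card_in:
  assumes "finite B" "finite J"
  shows "card {D. D \<subseteq> B \<and> card D \<in> J} = (\<Sum>j\<in>J. card B choose j)"
proof -
  have "{D. D \<subseteq> B \<and> card D \<in> J} = (\<Union>j\<in>J. {D. D \<subseteq> B \<and> card D = j})" by auto
  also have "card \<dots> = (\<Sum>j\<in>J. card {D. D \<subseteq> B \<and> card D = j})"
    using assms by (intro card_UN_disjoint) auto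
  finally show ?thesis using n_subsets[OF assms(1)] by simp
qed

theorem num_balanced_ones_lower:
  assumes "1 \<le> n" "even m \<longleftrightarrow> even d"
  shows "2 * binomial_sum (n - 1) d \<le> num_balanced ones n i m 1 (int d)"
proof -
  let ?few = "{D. D \<subseteq> {1..<n} \<and> card D \<in> {..d}}"
  have "card ?few = binomial_sum (n - 1) d"
    by (subst card_subsets_with_card_in) (simp_all add: binomial_sum_def)
  moreover have "2 * card ?few \<le> num_balanced ones n i m 1 (int d)"
  proof (rule num_balanced_ge_changes[OF assms(1)])
    fix D assume "D \<in> ?few"
    then have "D \<subseteq> {1..<n}" "finite D" "card D \<le> d" by (auto intro: finite_subset)
    then show "D \<subseteq> {1..<n} \<and> balanced ones n i m 1 (int d) (with_changes n D)"
      using balanced_few_changes assms(2) by blast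
  qed
  ultimately show ?thesis by simp
qed

text \<open>
  Up to complement there are \<open>1 + 11 + 55 = 67\<close> sets with at most two changes. Among the sets that are
  constant on \<open>{1,2}, \<dots>, {11,12}\<close> there are \<open>10 + 5 + 1\<close> with more changes, all of them at even places; among
  those that are constant on \<open>{2,3}, \<dots>, {12,1}\<close> there are \<open>15 + 1\<close> with more, all at odd places.
\<close>

lemma num_balanced_ones_12: "198 \<le> num_balanced ones 12 i 10 1 2"
proof -
  let ?B = "{2,4,6,8,10::nat}" and ?C = "{1,3,5,7,9,11::nat}"
  let ?few = "{D. D \<subseteq> {1..<12::nat} \<and> card D \<in> {..2}}"
  let ?ev = "{D. D \<subseteq> ?B \<and> card D \<in> {3,4,5}}"
  let ?od = "{D. D \<subseteq> ?C \<and> card D \<in> {4,6}}"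
  let ?D = "?few \<union> (?ev \<union> ?od)"
  have "?ev \<inter> ?od = {}"
  proof (rule ccontr)
    assume "?ev \<inter> ?od \<noteq> {}"
    then obtain D where "D \<subseteq> ?B \<inter> ?C" "card D \<in> {3,4,5}" by blast
    moreover have "?B \<inter> ?C = {}" by auto
    ultimately show False by auto
  qed
  moreover have fin: "finite ?few" "finite ?ev" "finite ?od" by (auto intro: finite_subset[of _ "Pow _"])
  ultimately have "card ?D = card ?few + (card ?ev + card ?od)"
    by (subst card_Un_disjoint) (auto simp: card_Un_disjoint)
  also have "card ?few = 67"
    by (subst card_subsets_with_card_in) (simp_all add: eval_nat_numeral)
  also have "card ?ev = 16"
    by (subst card_subsets_with_card_in) (simp_all add: eval_nat_numeral)
  also have "card ?od = 16"
    by (subst card_subsets_with_card_in) (simp_all add: eval_nat_numeral)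
  finally have card: "card ?D = 99" by simp
  have "balanced ones 12 i 10 1 2 (with_changes 12 D)" "D \<subseteq> {1..<12}" if D: "D \<in> ?D" for D
  proof -
    consider "D \<in> ?few" | "D \<in> ?ev" | "D \<in> ?od" using D by blast
    then have "balanced ones 12 i 10 1 2 (with_changes 12 D) \<and> D \<subseteq> {1..<12}"
    proof cases
      case 1
      then show ?thesis using balanced_few_changes[of D 2 10 12 i] finite_subset[of D "{1..<12}"] by simp
    next
      case 2
      then have D: "D \<subseteq> {1..<12}" "\<And>x. x \<in> D \<Longrightarrow> even x" by auto
      then show ?thesis using balanced_pairs[of 12 D i 2] by simp
    next
      case 3
      then have D: "D \<subseteq> {1..<12}" "\<And>x. x \<in> D \<Longrightarrow> odd x" "even (card D)" by auto
      then show ?thesis using balanced_cyclic_pairs[of 12 2 D i] by simp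
    qed
    then show "balanced ones 12 i 10 1 2 (with_changes 12 D)" "D \<subseteq> {1..<12}" by auto
  qed
  then have "2 * card ?D \<le> num_balanced ones 12 i 10 1 2"
    by (intro num_balanced_ge_changes) auto
  with card show ?thesis by simp
qed

section \<open>Comparison\<close>

lemma lawrence_cong:
  assumes "\<And>i x. i \<in> {1..r} \<Longrightarrow> x \<in> {1..n} \<Longrightarrow> A i x = A' i x"
  shows "lawrence r n A = lawrence r n A'"
proof -
  have "(\<forall>i\<in>{1..r}. X (j (i+1)) = - X (j i) * A i (j i) * A i (j (i+1))) \<longleftrightarrow>
        (\<forall>i\<in>{1..r}. X (j (i+1)) = - X (j i) * A' i (j i) * A' i (j (i+1)))"
    if "X \<in> sign_vectors {1..n}" "supp X = j ` {1..r+1}" for X j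
  proof -
    have "supp X \<subseteq> {1..n}"
      using that(1) unfolding sign_vectors_def supp_def pos_part_def neg_part_def by force
    then have "j i \<in> {1..n}" if "i \<in> {1..r+1}" for i
      using that \<open>supp X = j ` {1..r+1}\<close> by blast
    then show ?thesis using assms by (intro ball_cong refl) simp
  qed
  then show ?thesis unfolding lawrence_def by (simp cong: conj_cong)
qed

theorem corollary2p29:
  fixes n :: nat and M :: "nat signed_system"
  assumes "lawrence_oriented_matroid 9 n M" and "n \<ge> 12"
  shows "num_neighborly M 3 \<le> num_neighborly_alternating 9 n 3"
proof -
  obtain A where A: "sign_matrix 9 n A" and M: "M = lawrence 9 n A"
    using assms(1) by (auto simp: lawrence_oriented_matroid_def)
  \<comment> \<open>Entries outside the matrix carry no information; filling them with ones makes the sign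
    condition unconditional.\<close>
  define B where "B i x = (if i \<in> {1..9} \<and> x \<in> {1..n} then A i x else 1)" for i x
  have B: "B i x = 1 \<or> B i x = -1" for i x
    using A by (auto simp: B_def sign_matrix_def)
  have "M = lawrence 9 n B" unfolding M by (rule lawrence_cong) (simp add: B_def)
  moreover have "sign_matrix 9 n B" using A by (simp add: B_def sign_matrix_def)
  ultimately have f: "num_neighborly M 3 = num_balanced B n 1 10 1 2"
    by (simp add: num_neighborly_lawrence)
  have "sign_matrix 9 n ones" by (simp add: sign_matrix_def)
  then have c: "num_neighborly_alternating 9 n 3 = num_balanced ones n 1 10 1 2"
    by (simp add: num_neighborly_alternating_def alternating_eq_lawrence num_neighborly_lawrence)
  show ?thesis
  proof (cases "n = 12")
    case True
    have "num_balanced B n 1 10 1 2 \<le> 198"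
      using num_corank3[of B 1 3 n 1] B True by simp
    also have "198 \<le> num_balanced ones n 1 10 1 2"
      using num_balanced_ones_12[of 1] True by simp
    finally show ?thesis unfolding f c .
  next
    case False
    then have "num_balanced B n 1 10 1 2 \<le> 2 * binomial_sum (n - 1) 2"
      using num_balanced_upper[of B 1 3 2 n 1] B assms(2) by simp
    also have "\<dots> \<le> num_balanced ones n 1 10 1 2"
      using num_balanced_ones_lower[of n 10 2 1] assms(2) by simp
    finally show ?thesis unfolding f c .
  qed
qed

end
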